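(* Let $p>2$ and let $(W_k)_{k\in\mathbb{N}}$ be the stationary Markov chain described in the context with $a=p-1$. Then the condition $\sum_{n\ge1}n^{p-2}\,\mathbb{P}_{\nu\otimes\nu}(T^*\ge n)<\infty$ fails. In addition, for any map $f$ from $[0,1]$ to $\mathbb{R}$ with continuous and strictly positive derivative $f'$ on $[0,1]$, and any stationary and Gaussian centered sequence $(g_k)_{k\in\mathbb{Z}}$ with convergent series of covariances, $$\limsup_{n\to\infty}\,(n\log n)^{-1/p}\Big|\sum_{k=1}^nf(W_k^a)-n\int_0^1f(t)\,dt-\sum_{k=1}^ng_k\Big|>0\quad\text{almost surely.}$$
   Context: For $a>1$ let $\pi(dx)=(a+1)x^a\,dx$ and $\nu(dx)=ax^{a-1}\,dx$ on $[0,1]$, and consider the transition kernel $P(x,A)=(1-x)\delta_x(A)+x\pi(A)$ on $[0,1]$, whose unique invariant probability is $\nu$. The stationary chain is constructed as follows: $(\varepsilon_i)_{i\in\mathbb{Z}}=(U_i,V_i)_{i\in\mathbb{Z}}$ are independent random variables uniform on $[0,1]^2$, $W_0$ has law $\nu$ and is independent of them, and for $k\ge1$ $$W_k=W_{k-1}\mathbf{1}_{U_k\ge W_{k-1}}+F_\pi^{-1}(V_k)\mathbf{1}_{U_k<W_{k-1}},$$ where $F_\pi^{-1}$ is the inverse of the cumulative distribution function of $\pi$. Let $(W_k^* )$ be defined by the same recursion with the same $(U_k,V_k)$, started from $W_0^*$ of law $\nu$ independent of $(W_0,(\varepsilon_i))$; $T^*=\inf\{k\in\mathbb{N}:W_k=W_k^*\}$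 ($\mathbb{N}\ni0$), and $\mathbb{P}_{\nu\otimes\nu}$ refers to this choice of initial conditions. The Gaussian sequence $(g_k)$ is any such sequence defined on the same probability space as $(W_k)$ (with arbitrary joint law). *)

theory Defs
  imports "HOL-Probability.Probability"
begin

definition pi_law :: "real \<Rightarrow> real measure" where
  "pi_law a = density lborel (\<lambda>x. ennreal ((a + 1) * x powr a * indicator {0..1} x))"

definition nu_law :: "real \<Rightarrow> real measure" where
  "nu_law a = density lborel (\<lambda>x. ennreal (a * x powr (a - 1) * indicator {0..1} x))"

text \<open>The distribution function of \<open>pi_law a\<close> is a bijection of the unit interval onto itself;
  values of the inverse at arguments outside the unit interval are irrelevant.\<close>

definition pi_quantile :: "real \<Rightarrow> real \<Rightarrow> real" where
  "pi_quantile a = inv_into {0..1} (cdf (pi_law a))"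

text \<open>The pair \<open>\<epsilon> k w\<close> is \<open>(U\<^sub>k, V\<^sub>k)\<close>, indexed by all integers;
  only the indices \<open>k \<ge> 1\<close> drive the chain.\<close>

primrec chain ::
    "real \<Rightarrow> (int \<Rightarrow> 'w \<Rightarrow> real \<times> real) \<Rightarrow> ('w \<Rightarrow> real) \<Rightarrow> nat \<Rightarrow> 'w \<Rightarrow> real" where
  "chain a \<epsilon> W0 0 w = W0 w"
| "chain a \<epsilon> W0 (Suc k) w =
    (if fst (\<epsilon> (int (Suc k)) w) \<ge> chain a \<epsilon> W0 k w then chain a \<epsilon> W0 k w
     else pi_quantile a (snd (\<epsilon> (int (Suc k)) w)))"

text \<open>Equal to \<open>\<infinity>\<close> if the two trajectories never meet.\<close>

definition meeting_time :: "(nat \<Rightarrow> 'w \<Rightarrow> real) \<Rightarrow> (nat \<Rightarrow> 'w \<Rightarrow> real) \<Rightarrow> 'w \<Rightarrow> enat" where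
  "meeting_time W W' w = Inf {enat k |k. W k w = W' k w}"

context prob_space
begin

text \<open>Independence of two random variables whose values may lie in different types; the library's
  \<open>indep_var\<close> requires a common value type.\<close>

definition indep_pair :: "'b measure \<Rightarrow> ('a \<Rightarrow> 'b) \<Rightarrow> 'c measure \<Rightarrow> ('a \<Rightarrow> 'c) \<Rightarrow> bool" where
  "indep_pair N X N' Y \<longleftrightarrow> random_variable N X \<and> random_variable N' Y \<and>
     indep_set {X -` A \<inter> space M |A. A \<in> sets N} {Y -` B \<inter> space M |B. B \<in> sets N'}"

definition uniform_innovations :: "(int \<Rightarrow> 'a \<Rightarrow> real \<times> real) \<Rightarrow> bool" where
  "uniform_innovations \<epsilon> \<longleftrightarrow> indep_vars (\<lambda>_. borel) \<epsilon> UNIV \<and>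
     (\<forall>i. distr M borel (\<epsilon> i) = uniform_measure lborel ({0..1} \<times> {0..1}))"

text \<open>A sequence is Gaussian if all its finite linear combinations are normally distributed,
  degenerate normal laws being allowed.\<close>

definition gaussian_variable :: "('a \<Rightarrow> real) \<Rightarrow> bool" where
  "gaussian_variable X \<longleftrightarrow> random_variable borel X \<and>
     (\<exists>\<mu> \<sigma>. (\<sigma> = 0 \<and> distr M borel X = return borel \<mu>) \<or>
            (\<sigma> > 0 \<and> distr M borel X = density lborel (\<lambda>x. ennreal (normal_density \<mu> \<sigma> x))))"

definition gaussian_sequence :: "(int \<Rightarrow> 'a \<Rightarrow> real) \<Rightarrow> bool" where
  "gaussian_sequence g \<longleftrightarrow>
     (\<forall>J c. finite J \<longrightarrow> gaussian_variable (\<lambda>w. \<Sum>k\<in>J. c k * g k w))"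

definition stationary_sequence :: "(int \<Rightarrow> 'a \<Rightarrow> real) \<Rightarrow> bool" where
  "stationary_sequence g \<longleftrightarrow> (\<forall>k. random_variable borel (g k)) \<and>
     (\<forall>h. distr M (PiM UNIV (\<lambda>_. borel)) (\<lambda>w k. g (k + h) w) =
          distr M (PiM UNIV (\<lambda>_. borel)) (\<lambda>w k. g k w))"

definition centered_sequence :: "(int \<Rightarrow> 'a \<Rightarrow> real) \<Rightarrow> bool" where
  "centered_sequence g \<longleftrightarrow> (\<forall>k. integrable M (g k) \<and> expectation (g k) = 0)"

definition covariance :: "('a \<Rightarrow> real) \<Rightarrow> ('a \<Rightarrow> real) \<Rightarrow> real" where
  "covariance X Y = expectation (\<lambda>w. (X w - expectation X) * (Y w - expectation Y))"

text \<open>For stationary sequences the covariance is even in the lag, so convergence of the series over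
  all integer lags is convergence of the series over nonnegative lags. Absolute convergence is not
  required.\<close>

definition convergent_covariances :: "(int \<Rightarrow> 'a \<Rightarrow> real) \<Rightarrow> bool" where
  "convergent_covariances g \<longleftrightarrow> summable (\<lambda>k::nat. covariance (g 0) (g (int k)))"

end

end

theory Submission
  imports Defs "HOL-Real_Asymp.Real_Asymp"
begin

text \<open>The invariant law \<open>\<nu>\<close> gives mass \<open>y\<^sup>a\<close> to \<open>[0, y]\<close>, and a chain sitting at \<open>x\<close> stays there for a
  time of order \<open>1 / x\<close>. Both claims come from these long sojourns near \<open>0\<close>.

  For the coupling time: with probability at least \<open>e\<inverse> (n + 1)\<^sup>-\<^sup>a\<close> one has \<open>W\<^sub>0 \<le> 1 / (n + 1)\<close> and
  \<open>U\<^sub>k \<ge> 1 / (n + 1)\<close> for \<open>1 \<le> k \<le> n\<close>. The first trajectory then stands still at \<open>W\<^sub>0\<close> up to time \<open>n\<close>. The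
  second one only takes values among \<open>W\<^sub>0\<^sup>*\<close> and the fresh jump points, each independent of \<open>W\<^sub>0\<close>, whose law
  has no atoms; so the two do not meet before time \<open>n + 1\<close>, and the term of index \<open>n + 1\<close> of the series
  is at least \<open>e\<inverse> / (n + 1)\<close> (lemma \<open>meeting_time_series_diverges\<close>).

  For the almost sure lower bound, put \<open>b\<^sub>n = (n log n)\<^bsup>1/p\<^esup>\<close> with \<open>p = a + 1\<close>. Almost surely, for
  infinitely many \<open>n\<close> the chain rests during \<open>L\<^sub>n \<approx> b\<^sub>n\<close> steps after time \<open>n\<close> at a point as close to \<open>0\<close> as
  desired (lemma \<open>frequently_low_sojourn\<close>). Over such a stretch the centred sum of \<open>f(W\<^sub>k\<^sup>a)\<close> decreases
  by at least \<open>L\<^sub>n (\<integral>f - f(0)) / 2\<close>, and \<open>\<integral>f > f(0)\<close> because \<open>f\<close> is strictly increasing. A Gaussian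
  sequence with convergent series of covariances has increments of variance \<open>O(L\<^sub>n)\<close> over blocks of
  length \<open>L\<^sub>n\<close>; as \<open>L\<^sub>n\<close> grows like a power of \<open>n\<close>, its increments over \<open>[n, n + L\<^sub>n]\<close> are almost surely
  \<open>o(L\<^sub>n)\<close> (lemma \<open>eventually_increment_small\<close>). This uses only the law of the Gaussian sequence, so
  the joint law with the chain is irrelevant. If the normalised difference of the two sums tended
  to \<open>0\<close>, its increments over these stretches would be \<open>o(b\<^sub>n)\<close>, a contradiction
  (lemma \<open>limsup_pos_of_large_increments\<close>).

  The sojourns are produced without renewal theory. Let \<open>\<eta>\<^sub>n\<close> decrease to \<open>0\<close> very slowly, put
  \<open>x\<^sub>n = \<eta>\<^sub>n / b\<^sub>n\<close>, and let \<open>C\<^sub>n\<close> be the event that \<open>U\<^sub>n < \<eta>\<^sub>n\<close> and \<open>V\<^sub>n \<le> x\<^sub>n\<^sup>p\<close>. The events \<open>C\<^sub>n\<close> are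
  independent. On \<open>C\<^sub>n\<close> the chain jumps at time \<open>n\<close> to a point of \<open>[0, x\<^sub>n]\<close> and stays there for \<open>L\<^sub>n\<close>
  steps, unless \<open>W\<^sub>n\<^sub>-\<^sub>1 < \<eta>\<^sub>n\<close> or some \<open>U\<^sub>n\<^sub>+\<^sub>j\<close> with \<open>j \<le> L\<^sub>n\<close> is below \<open>x\<^sub>n\<close>. These two obstructions are
  independent of \<open>C\<^sub>n\<close> and have probabilities at most \<open>\<eta>\<^sub>n\<^sup>a\<close> (by stationarity) and \<open>O(\<eta>\<^sub>n)\<close>. With
  \<open>\<eta>\<^sub>n = (\<Sum>k\<le>n. 1 / (k log k))\<^bsup>-1/(p+1)\<^esup>\<close> the Abel-Dini theorem says that the probabilities of
  \<open>C\<^sub>n\<close> have divergent sum, and that they become summable when multiplied by either of these bounds.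
  The two Borel-Cantelli lemmas conclude.\<close>

section \<open>Series and an elementary integral inequality\<close>

lemma filterlim_partial_sums_at_top:
  fixes c :: "nat \<Rightarrow> real"
  assumes nonneg: "\<And>n. c n \<ge> 0" and div: "\<not> summable c"
  shows "filterlim (\<lambda>n. \<Sum>k\<le>n. c k) at_top sequentially"
proof -
  have mono: "mono (\<lambda>n. \<Sum>k\<le>n. c k)"
    by (rule monoI, rule sum_mono2) (use nonneg in auto)
  have "\<exists>n. Z < (\<Sum>k\<le>n. c k)" for Z
  proof (rule ccontr)
    assume "\<not> (\<exists>n. Z < (\<Sum>k\<le>n. c k))"
    then have "(\<Sum>k\<le>n. c k) \<le> Z" for n
      by (simp add: not_less)
    then have "(\<Sum>k<n. c k) \<le> Z" for n
      using sum_mono2[of "{..n}" "{..<n}" c] nonneg order_trans by (metis finite_atMost lessThan_subset_iff lessThan_Suc_atMost le_SucI order_refl)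
    then have "summable c"
      using nonneg by (intro summableI_nonneg_bounded) auto
    with div show False by simp
  qed
  note unbounded = this
  show ?thesis
    unfolding filterlim_at_top_dense
  proof
    fix Z
    obtain N where "Z < (\<Sum>k\<le>N. c k)" using unbounded by blast
    then have "Z < (\<Sum>k\<le>n. c k)" if "n \<ge> N" for n
      using monoD[OF mono that] by linarith
    then show "eventually (\<lambda>n. Z < (\<Sum>k\<le>n. c k)) sequentially"
      by (auto simp: eventually_sequentially)
  qed
qed

text \<open>The Abel-Dini theorem: dividing the terms of a divergent series by its partial sums keeps it
  divergent, while any larger power of the partial sums makes it converge.\<close>

lemma abel_dini_divergent:
  fixes c :: "nat \<Rightarrow> real"
  assumes pos: "\<And>n. c n > 0" and div: "\<not> summable c"
  shows "\<not> summable (\<lambda>n. c n / (\<Sum>k\<le>n. c k))"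
proof
  define S where "S = (\<lambda>n. \<Sum>k\<le>n. c k)"
  assume "summable (\<lambda>n. c n / (\<Sum>k\<le>n. c k))"
  then have "summable (\<lambda>n. c n / S n)"
    by (simp add: S_def)
  then obtain N where N: "\<And>m n. m \<ge> N \<Longrightarrow> norm (\<Sum>k=m..<n. c k / S k) < 1/2"
    unfolding summable_Cauchy by (metis half_gt_zero zero_less_one)
  have S_pos: "S n > 0" for n
    unfolding S_def using pos by (intro sum_pos) auto
  have "filterlim S at_top sequentially"
    unfolding S_def using pos div by (intro filterlim_partial_sums_at_top) (auto intro: less_imp_le)
  then have "eventually (\<lambda>n. S n \<ge> 2 * S N) sequentially"
    unfolding filterlim_at_top by blast
  with eventually_ge_at_top[of N] have "eventually (\<lambda>n. n \<ge> N \<and> S n \<ge> 2 * S N) sequentially"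
    by eventually_elim auto
  then obtain n where n: "n \<ge> N" "S n \<ge> 2 * S N"
    unfolding eventually_sequentially by blast
  have S_mono: "S k \<le> S n" if "k \<le> n" for k
    unfolding S_def using pos that by (intro sum_mono2) (auto intro: less_imp_le)
  have "S n = S N + (\<Sum>k=Suc N..<Suc n. c k)"
  proof -
    have "{..n} = {..N} \<union> {Suc N..<Suc n}" using n by auto
    moreover have "sum c ({..N} \<union> {Suc N..<Suc n}) = sum c {..N} + sum c {Suc N..<Suc n}"
      by (intro sum.union_disjoint) auto
    ultimately show ?thesis unfolding S_def by metis
  qed
  then have "1/2 \<le> (\<Sum>k=Suc N..<Suc n. c k) / S n"
    using n S_pos[of n] by (simp add: field_simps)
  also have "\<dots> = (\<Sum>k=Suc N..<Suc n. c k / S n)"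
    by (rule sum_divide_distrib)
  also have "\<dots> \<le> (\<Sum>k=Suc N..<Suc n. c k / S k)"
    using S_mono S_pos pos by (intro sum_mono divide_left_mono) (auto intro: less_imp_le)
  finally have "1/2 \<le> norm (\<Sum>k=Suc N..<Suc n. c k / S k)"
    by simp
  with N[of "Suc N" "Suc n"] show False
    by simp
qed

lemma abel_dini_convergent:
  fixes c :: "nat \<Rightarrow> real" and s :: real
  assumes pos: "\<And>n. c n > 0" and s: "s > 0"
  shows "summable (\<lambda>n. c n / (\<Sum>k\<le>n. c k) powr (1 + s))"
proof -
  define S where "S = (\<lambda>n. \<Sum>k\<le>n. c k)"
  define T where "T = (\<lambda>n. S n powr (- s))"
  have S_pos: "S n > 0" for n
    unfolding S_def using pos by (intro sum_pos) auto
  have S_Suc: "S (Suc n) = S n + c (Suc n)" for n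
    by (simp add: S_def)
  \<comment> \<open>By the mean value theorem for \<open>t \<mapsto> t powr (-s)\<close>, the terms are dominated by a telescoping series.\<close>
  have step: "c (Suc n) / S (Suc n) powr (1 + s) \<le> (T n - T (Suc n)) / s" for n
  proof -
    have less: "S n < S (Suc n)"
      using pos S_Suc by simp
    have "\<exists>z>S n. z < S (Suc n) \<and> S (Suc n) powr (- s) - S n powr (- s)
        = (S (Suc n) - S n) * (- s * z powr (- s - 1))"
      using less S_pos[of n] by (intro MVT2) (auto intro!: derivative_eq_intros)
    then obtain z where z: "z > S n" "z < S (Suc n)"
      and eq: "T (Suc n) - T n = c (Suc n) * (- s * z powr (- s - 1))"
      unfolding T_def using S_Suc by auto
    have "S (Suc n) powr (- s - 1) \<le> z powr (- s - 1)"
      using z s S_pos[of n] by (intro powr_mono2') auto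
    then have "c (Suc n) * S (Suc n) powr (- s - 1) \<le> c (Suc n) * z powr (- s - 1)"
      using pos[of "Suc n"] by simp
    also have "\<dots> = (T n - T (Suc n)) / s"
      using eq s by (simp add: field_simps)
    also have "- s - 1 = - (1 + s)"
      by simp
    also have "S (Suc n) powr - (1 + s) = 1 / S (Suc n) powr (1 + s)"
      by (rule powr_minus_divide)
    finally show ?thesis by simp
  qed
  have "decseq T"
    unfolding decseq_Suc_iff T_def using pos S_Suc S_pos s by (auto intro!: powr_mono2' simp: less_imp_le)
  then obtain L where "T \<longlonglongrightarrow> L"
    by (rule decseq_convergent[where B = 0]) (auto simp: T_def)
  then have "summable (\<lambda>n. (T n - T (Suc n)) / s)"
    by (intro summable_divide telescope_summable')
  then have "summable (\<lambda>n. c (Suc n) / S (Suc n) powr (1 + s))"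
    by (rule summable_comparison_test_ev[rotated]) (use step pos in \<open>auto simp: less_imp_le\<close>)
  then show ?thesis
    unfolding S_def by (subst (asm) summable_Suc_iff)
qed

lemma not_summable_inverse_n_ln_n:
  "\<not> summable (\<lambda>n. 1 / (real n * ln (real n)))"
proof
  assume sum: "summable (\<lambda>n. 1 / (real n * ln (real n)))"
  define T where "T = (\<lambda>n. ln (ln (real (n + 2))))"
  \<comment> \<open>The function \<open>ln \<circ> ln\<close> has derivative \<open>1 / (z ln z)\<close>.\<close>
  have step: "T (Suc n) - T n \<le> 1 / (real (n + 2) * ln (real (n + 2)))" for n
  proof -
    have "\<exists>z>real (n + 2). z < real (n + 3) \<and> ln (ln (real (n + 3))) - ln (ln (real (n + 2)))
        = (real (n + 3) - real (n + 2)) * (1 / (z * ln z))"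
      by (intro MVT2) (auto intro!: derivative_eq_intros simp: field_simps)
    then obtain z where z: "z > real (n + 2)" and eq: "T (Suc n) - T n = 1 / (z * ln z)"
      unfolding T_def by (auto simp: algebra_simps numeral_eq_Suc)
    have "real (n + 2) * ln (real (n + 2)) \<le> z * ln z"
      using z by (intro mult_mono) auto
    then show ?thesis
      unfolding eq using z by (intro divide_left_mono mult_pos_pos) auto
  qed
  have T_eq: "T n = T 0 + (\<Sum>k<n. T (Suc k) - T k)" for n
    by (simp add: sum_lessThan_telescope)
  have "T n \<le> T 0 + (\<Sum>k. 1 / (real (k + 2) * ln (real (k + 2))))" for n
  proof -
    have "(\<Sum>k<n. T (Suc k) - T k) \<le> (\<Sum>k<n. 1 / (real (k + 2) * ln (real (k + 2))))"
      by (intro sum_mono step)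
    also have "\<dots> \<le> (\<Sum>k. 1 / (real (k + 2) * ln (real (k + 2))))"
      using sum by (intro sum_le_suminf) (simp_all only: summable_iff_shift[of "\<lambda>n. 1 / (real n * ln (real n))" 2], auto)
    finally show ?thesis using T_eq[of n] by linarith
  qed
  moreover have "filterlim T at_top sequentially"
    unfolding T_def by real_asymp
  ultimately show False
    by (metis (no_types, lifting) eventually_happens filterlim_at_top_dense leD sequentially_bot)
qed

lemma initial_value_less_integral:
  fixes f f' :: "real \<Rightarrow> real"
  assumes deriv: "\<And>t. t \<in> {0..1} \<Longrightarrow> (f has_real_derivative f' t) (at t within {0..1})"
    and pos: "\<And>t. t \<in> {0..1} \<Longrightarrow> f' t > 0"
  shows "f 0 < integral {0..1} f"
proof -
  have cont: "continuous_on {0..1} f"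
    using deriv DERIV_continuous_on by blast
  have incr: "f 0 < f t" if "0 < t" "t \<le> 1" for t
  proof (rule DERIV_pos_imp_increasing_open[OF \<open>0 < t\<close>])
    fix x assume "0 < x" "x < t"
    with that have "x \<in> {0..1}" "x \<in> interior {0..1}" by auto
    then show "\<exists>y. (f has_real_derivative y) (at x) \<and> y > 0"
      using deriv[of x] pos[of x] at_within_interior by metis
  qed (use cont that in \<open>auto elim: continuous_on_subset\<close>)
  have cont': "continuous_on {0..1} (\<lambda>t. f t - f 0)"
    by (intro continuous_intros cont)
  have nonneg: "f t - f 0 \<ge> 0" if "t \<in> {0..1}" for t
    using incr[of t] that by (cases "t = 0") auto
  have "integral {0..1} (\<lambda>t. f t - f 0) \<noteq> 0"
  proof
    assume "integral {0..1} (\<lambda>t. f t - f 0) = 0"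
    then have "\<forall>t\<in>{0..1}. f t - f 0 = 0"
      using integral_eq_0_iff[OF cont' zero_less_one nonneg] by blast
    then have "f 1 - f 0 = 0"
      by (rule bspec) simp
    with incr[of 1] show False by simp
  qed
  moreover have "integral {0..1} (\<lambda>t. f t - f 0) \<ge> 0"
    by (intro integral_nonneg integrable_continuous_real cont') (use nonneg in auto)
  moreover have "integral {0..1} (\<lambda>t. f t - f 0) = integral {0..1} f - f 0"
    using integral_diff[OF integrable_continuous_real[OF cont] integrable_const_ivl[of "f 0" 0 1]]
    by simp
  ultimately show ?thesis by simp
qed

section \<open>The laws of the jumps and of the stationary state\<close>

text \<open>The uniform law on the unit interval.\<close>

abbreviation unif :: "real measure" where
  "unif \<equiv> uniform_measure lborel {0..1}"

lemma prob_space_unif: "prob_space unif"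
  by (rule prob_space_uniform_measure) auto

lemma ennreal_divide_one [simp]: "(x :: ennreal) / 1 = x"
  by (simp add: divide_ennreal_def)

lemma emeasure_unif: "A \<in> sets borel \<Longrightarrow> emeasure unif A = emeasure lborel ({0..1} \<inter> A)"
  by (simp add: divide_ennreal_def)

lemma emeasure_unif_atMost: "0 \<le> x \<Longrightarrow> x \<le> 1 \<Longrightarrow> emeasure unif {0..x} = ennreal x"
  by (simp add: emeasure_unif)

lemma emeasure_unif_lessThan: "0 \<le> x \<Longrightarrow> x \<le> 1 \<Longrightarrow> emeasure unif {..<x} = ennreal x"
proof -
  assume "0 \<le> x" "x \<le> 1"
  then have "{0..1} \<inter> {..<x} = {0..<x}" by auto
  with \<open>0 \<le> x\<close> show ?thesis by (simp add: emeasure_unif)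
qed

lemma emeasure_unif_atLeast: "0 \<le> x \<Longrightarrow> x \<le> 1 \<Longrightarrow> emeasure unif {x..} = ennreal (1 - x)"
proof -
  assume "0 \<le> x" "x \<le> 1"
  then have "{0..1} \<inter> {x..} = {x..1}" by auto
  with \<open>x \<le> 1\<close> show ?thesis by (simp add: emeasure_unif)
qed

lemma uniform_square_eq:
  "uniform_measure lborel ({0..1} \<times> {0..1} :: (real \<times> real) set) = unif \<Otimes>\<^sub>M unif"
proof (rule pair_measure_eqI[symmetric])
  show "sigma_finite_measure unif" "sigma_finite_measure unif"
    using prob_space_unif by (simp_all add: prob_space_imp_sigma_finite)
  show "sets (unif \<Otimes>\<^sub>M unif) = sets (uniform_measure lborel ({0..1} \<times> {0..1} :: (real \<times> real) set))"
    by (simp add: borel_prod[symmetric] cong: sets_pair_measure_cong)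
next
  fix A B assume "A \<in> sets unif" "B \<in> sets unif"
  then have [measurable]: "A \<in> sets borel" "B \<in> sets borel" by simp_all
  have times: "emeasure lborel (C \<times> D) = emeasure lborel C * emeasure lborel D"
    if "C \<in> sets borel" "D \<in> sets borel" for C D :: "real set"
    using that lborel.emeasure_pair_measure_Times[of C lborel D] by (simp add: lborel_prod)
  have "emeasure (uniform_measure lborel ({0..1} \<times> {0..1} :: (real \<times> real) set)) (A \<times> B)
      = emeasure lborel (({0..1} \<inter> A) \<times> ({0..1} \<inter> B))"
    using times[of "{0..1}" "{0..1}"]
    by (subst emeasure_uniform_measure) (auto simp: divide_ennreal_def borel_prod[symmetric] Times_Int_Times[symmetric])
  also have "\<dots> = emeasure unif A * emeasure unif B"
    by (simp add: times emeasure_unif)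
  finally show "emeasure unif A * emeasure unif B
      = emeasure (uniform_measure lborel ({0..1} \<times> {0..1} :: (real \<times> real) set)) (A \<times> B)" ..
qed

text \<open>Both laws belong to one family, so that facts about \<open>nu_law b\<close> for all \<open>b > 0\<close> cover \<open>pi_law\<close>.\<close>

lemma pi_law_eq_nu_law: "pi_law a = nu_law (a + 1)"
  by (simp add: pi_law_def nu_law_def)

lemma sets_nu_law [simp, measurable_cong]: "sets (nu_law b) = sets borel"
  by (simp add: nu_law_def)

lemma space_nu_law [simp]: "space (nu_law b) = UNIV"
  by (simp add: nu_law_def)

lemma emeasure_nu_law:
  assumes b: "b > 0" and A: "A \<in> sets borel" and y: "0 \<le> y" "y \<le> 1" and "A \<inter> {0..1} = {0..y}"
  shows "emeasure (nu_law b) A = ennreal (y powr b)"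
proof -
  have "emeasure (nu_law b) A
      = (\<integral>\<^sup>+x. ennreal (b * x powr (b - 1) * indicator {0..1} x) * indicator A x \<partial>lborel)"
    unfolding nu_law_def using A by (intro emeasure_density) auto
  also have "\<dots> = (\<integral>\<^sup>+x. ennreal (b * x powr (b - 1)) * indicator {0..y} x \<partial>lborel)"
    by (intro nn_integral_cong) (use assms(5) in \<open>auto simp: indicator_def split: if_splits\<close>)
  also have "\<dots> = ennreal (b * (y powr b / b))"
    using has_integral_mult_right[OF has_integral_powr_from_0[of "b - 1" y], of b] b y
    by (intro nn_integral_has_integral_lebesgue') auto
  finally show ?thesis using b by simp
qed

lemma prob_space_nu_law: "b > 0 \<Longrightarrow> prob_space (nu_law b)"
  by (rule prob_spaceI) (simp add: emeasure_nu_law[where y = 1])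

lemma real_distribution_nu_law: "b > 0 \<Longrightarrow> real_distribution (nu_law b)"
  by (simp add: real_distribution_def real_distribution_axioms_def prob_space_nu_law)

lemma emeasure_nu_law_atMost:
  "b > 0 \<Longrightarrow> 0 \<le> y \<Longrightarrow> y \<le> 1 \<Longrightarrow> emeasure (nu_law b) {..y} = ennreal (y powr b)"
  by (rule emeasure_nu_law) auto

lemma emeasure_nu_law_singleton: "emeasure (nu_law b) {x} = 0"
proof -
  have "absolutely_continuous lborel (nu_law b)"
    unfolding nu_law_def by (rule absolutely_continuousI_density) auto
  moreover have "{x} \<in> null_sets lborel"
    by auto
  ultimately have "{x} \<in> null_sets (nu_law b)"
    unfolding absolutely_continuous_def by blast
  then show ?thesis by auto
qed

lemma AE_nu_law_unit: "AE x in nu_law b. x \<in> {0..1}"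
  unfolding nu_law_def by (subst AE_density) (auto simp: indicator_def intro!: AE_I2)

lemma cdf_pi_law:
  assumes a: "a > 0"
  shows "cdf (pi_law a) x = (if x < 0 then 0 else if x \<le> 1 then x powr (a + 1) else 1)"
proof -
  have "AE y in nu_law (a + 1). \<not> y \<le> x" if "x < 0"
    using AE_nu_law_unit by eventually_elim (use that in auto)
  then have "emeasure (nu_law (a + 1)) {..x} = 0" if "x < 0"
    using that emeasure_eq_0_AE[of "\<lambda>y. y \<le> x" "nu_law (a + 1)"] by (simp add: atMost_def)
  moreover have "emeasure (nu_law (a + 1)) {..x} = ennreal (x powr (a + 1))" if "0 \<le> x" "x \<le> 1"
    using a that by (intro emeasure_nu_law_atMost) auto
  moreover have "emeasure (nu_law (a + 1)) {..x} = 1" if "1 < x"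
    using a that emeasure_nu_law[of "a + 1" "{..x}" 1] by force
  ultimately show ?thesis
    by (auto simp: cdf_def measure_def pi_law_eq_nu_law)
qed

lemma pi_quantile_eq:
  assumes a: "a > 0" and v: "0 \<le> v" "v \<le> 1"
  shows "pi_quantile a v = v powr (1 / (a + 1))"
  unfolding pi_quantile_def
proof (rule inv_into_f_eq)
  show "inj_on (cdf (pi_law a)) {0..1}"
  proof (rule inj_onI)
    fix x y :: real
    assume "x \<in> {0..1}" "y \<in> {0..1}" "cdf (pi_law a) x = cdf (pi_law a) y"
    then show "x = y"
      using a powr_less_mono2[of "a + 1" x y] powr_less_mono2[of "a + 1" y x]
      by (cases x y rule: linorder_cases) (auto simp: cdf_pi_law)
  qed
  show "v powr (1 / (a + 1)) \<in> {0..1}"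
    using a v by (auto intro!: powr_le1)
  then show "cdf (pi_law a) (v powr (1 / (a + 1))) = v"
    using a v by (auto simp: cdf_pi_law powr_powr)
qed

lemma pi_quantile_le_iff:
  assumes a: "a > 0" and v: "0 \<le> v" "v \<le> 1" and x: "0 \<le> x"
  shows "pi_quantile a v \<le> x \<longleftrightarrow> v \<le> cdf (pi_law a) x"
proof -
  have q: "pi_quantile a v \<ge> 0" "pi_quantile a v \<le> 1" "(pi_quantile a v) powr (a + 1) = v"
    using a v by (auto simp: pi_quantile_eq powr_powr intro!: powr_le1)
  show ?thesis
  proof (cases "x > 1")
    case True
    then show ?thesis using q v a by (auto simp: cdf_pi_law)
  next
    case False
    have "pi_quantile a v \<le> x \<longleftrightarrow> pi_quantile a v powr (a + 1) \<le> x powr (a + 1)"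
      using powr_mono2[of "a + 1" "pi_quantile a v" x] powr_less_mono2[of "a + 1" x "pi_quantile a v"] q a x
      by linarith
    then show ?thesis using q False a x by (auto simp: cdf_pi_law)
  qed
qed

lemma pi_quantile_measurable [measurable]:
  assumes a: "a > 0"
  shows "pi_quantile a \<in> borel_measurable borel"
proof -
  have img: "cdf (pi_law a) ` {0..1} \<subseteq> {0..1}"
    using a by (auto simp: cdf_pi_law powr_le1)
  \<comment> \<open>Outside the unit interval the quantile has one unspecified value.\<close>
  have "pi_quantile a v = (SOME x. False)" if "v \<notin> {0..1}" for v
    unfolding pi_quantile_def inv_into_def using that img by (intro arg_cong[where f = Eps] ext) blast
  then have "pi_quantile a = (\<lambda>v. if v \<in> {0..1} then v powr (1 / (a + 1)) else (SOME x. False))"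
    using a by (auto simp: pi_quantile_eq)
  then show ?thesis by simp
qed

lemma distr_pi_quantile:
  assumes a: "a > 0"
  shows "distr unif borel (pi_quantile a) = pi_law a"
proof (rule cdf_unique)
  interpret prob_space unif by (rule prob_space_unif)
  note [measurable] = pi_quantile_measurable[OF a]
  show "real_distribution (distr unif borel (pi_quantile a))"
    by (rule real_distribution_distr) simp
  show "real_distribution (pi_law a)"
    using a by (simp add: pi_law_eq_nu_law real_distribution_nu_law)
  show "cdf (distr unif borel (pi_quantile a)) = cdf (pi_law a)"
  proof
    fix x
    have "emeasure unif (pi_quantile a -` {..x}) = ennreal (cdf (pi_law a) x)"
    proof (cases "x < 0")
      case True
      then have "{0..1} \<inter> pi_quantile a -` {..x} = {}"
        using a order_trans[OF powr_ge_zero] by (fastforce simp: pi_quantile_eq)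
      then show ?thesis using True a
        using emeasure_unif[OF measurable_sets_borel[OF pi_quantile_measurable[OF a], of "{..x}"]]
        by (simp add: cdf_pi_law)
    next
      case False
      have "0 \<le> cdf (pi_law a) x" "cdf (pi_law a) x \<le> 1"
        using False a powr_le1[of "a + 1" x] by (auto simp: cdf_pi_law)
      have "{0..1} \<inter> pi_quantile a -` {..x} = {0..cdf (pi_law a) x}"
      proof (intro set_eqI)
        fix v show "v \<in> {0..1} \<inter> pi_quantile a -` {..x} \<longleftrightarrow> v \<in> {0..cdf (pi_law a) x}"
          using pi_quantile_le_iff[OF a, of v x] False \<open>cdf (pi_law a) x \<le> 1\<close> by auto
      qed
      with \<open>0 \<le> cdf (pi_law a) x\<close> show ?thesis
        using emeasure_unif[OF measurable_sets_borel[OF pi_quantile_measurable[OF a], of "{..x}"]]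
        by simp
    qed
    moreover have "cdf (pi_law a) x \<ge> 0"
      using a by (auto simp: cdf_pi_law)
    ultimately show "cdf (distr unif borel (pi_quantile a)) x = cdf (pi_law a) x"
      by (simp add: cdf_def[of "distr unif borel (pi_quantile a)"] measure_def emeasure_distr)
  qed
qed

text \<open>One transition of the chain from \<open>x\<close> driven by the pair \<open>z = (u, v)\<close>.\<close>

definition chain_step :: "real \<Rightarrow> real \<Rightarrow> real \<times> real \<Rightarrow> real" where
  "chain_step a x z = (if fst z \<ge> x then x else pi_quantile a (snd z))"

lemma chain_Suc_eq_step: "chain a \<epsilon> W0 (Suc k) w = chain_step a (chain a \<epsilon> W0 k w) (\<epsilon> (int (Suc k)) w)"
  by (simp add: chain_step_def)

lemma chain_step_measurable [measurable]:
  "a > 0 \<Longrightarrow> (\<lambda>(x, z). chain_step a x z) \<in> borel_measurable (borel \<Otimes>\<^sub>M (borel \<Otimes>\<^sub>M borel))"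
  unfolding chain_step_def by (simp add: case_prod_beta)

lemma nn_integral_nu_law_id:
  assumes a: "a > 0" and A: "A \<in> sets borel"
  shows "(\<integral>\<^sup>+x. ennreal x * indicator A x \<partial>nu_law a) = ennreal (a / (a + 1)) * emeasure (pi_law a) A"
proof -
  have "(\<integral>\<^sup>+x. ennreal x * indicator A x \<partial>nu_law a)
      = (\<integral>\<^sup>+x. ennreal (a * x powr (a - 1) * indicator {0..1} x) * (ennreal x * indicator A x) \<partial>lborel)"
    unfolding nu_law_def using A by (subst nn_integral_density) auto
  also have "\<dots> = (\<integral>\<^sup>+x. ennreal (a / (a + 1)) * (ennreal ((a + 1) * x powr a * indicator {0..1} x) * indicator A x) \<partial>lborel)"
  proof (rule nn_integral_cong)
    fix x :: real
    have "x powr (a - 1) * x = x powr a" if "x \<ge> 0"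
      using that powr_mult_base[of x "a - 1"] by (simp add: mult.commute)
    then show "ennreal (a * x powr (a - 1) * indicator {0..1} x) * (ennreal x * indicator A x)
        = ennreal (a / (a + 1)) * (ennreal ((a + 1) * x powr a * indicator {0..1} x) * indicator A x)"
      using a by (auto simp: indicator_def ennreal_mult[symmetric] mult.assoc)
  qed
  also have "\<dots> = ennreal (a / (a + 1)) * emeasure (pi_law a) A"
    unfolding pi_law_def using A by (simp add: nn_integral_cmult emeasure_density)
  finally show ?thesis .
qed

text \<open>Invariance of \<open>nu_law a\<close>. From \<open>x\<close> the chain stays with probability \<open>1 - x\<close> and moves to a point
  of law \<open>pi_law a\<close> with probability \<open>x\<close>; the mass lost on \<open>A\<close> by the jumps is \<open>\<integral>\<^sub>A x d\<nu>\<close>, the mass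
  gained is \<open>(\<integral>x d\<nu>) \<pi>(A)\<close>, and they agree because \<open>\<pi>\<close> is proportional to \<open>x d\<nu>\<close>.\<close>

lemma nu_law_invariant:
  assumes a: "a > 0" and A: "A \<in> sets borel"
  shows "(\<integral>\<^sup>+x. emeasure (unif \<Otimes>\<^sub>M unif) {z. chain_step a x z \<in> A} \<partial>nu_law a) = emeasure (nu_law a) A"
proof -
  interpret U: prob_space unif by (rule prob_space_unif)
  note [measurable] = pi_quantile_measurable[OF a] A
  have step: "emeasure (unif \<Otimes>\<^sub>M unif) {z. chain_step a x z \<in> A}
      = ennreal (1 - x) * indicator A x + ennreal x * emeasure (pi_law a) A"
    if "x \<in> {0..1}" for x
  proof -
    have q: "pi_quantile a -` A \<in> sets borel"
      using measurable_sets_borel[OF pi_quantile_measurable[OF a] A] .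
    have "{z. chain_step a x z \<in> A}
        = {x..} \<times> (if x \<in> A then UNIV else {}) \<union> {..<x} \<times> (pi_quantile a -` A)"
      by (auto simp: chain_step_def split: if_splits)
    also have "emeasure (unif \<Otimes>\<^sub>M unif) \<dots> =
        emeasure (unif \<Otimes>\<^sub>M unif) ({x..} \<times> (if x \<in> A then UNIV else {})) +
        emeasure (unif \<Otimes>\<^sub>M unif) ({..<x} \<times> (pi_quantile a -` A))"
      using q by (intro plus_emeasure[symmetric]) auto
    also have "\<dots> = emeasure unif {x..} * emeasure unif (if x \<in> A then UNIV else {}) +
        emeasure unif {..<x} * emeasure unif (pi_quantile a -` A)"
      using q by (intro arg_cong2[where f = "(+)"] U.emeasure_pair_measure_Times) auto
    also have "emeasure unif (pi_quantile a -` A) = emeasure (pi_law a) A"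
      by (subst distr_pi_quantile[OF a, symmetric]) (simp add: emeasure_distr)
    also have "emeasure unif {x..} * emeasure unif (if x \<in> A then UNIV else {}) = ennreal (1 - x) * indicator A x"
      using that emeasure_unif_atLeast[of x] U.emeasure_space_1 by auto
    finally show ?thesis
      using that emeasure_unif_lessThan[of x] by simp
  qed
  have pi1: "emeasure (pi_law a) UNIV = 1"
    using prob_space.emeasure_space_1[OF prob_space_nu_law[of "a + 1"]] a by (simp add: pi_law_eq_nu_law)
  have "(\<integral>\<^sup>+x. emeasure (unif \<Otimes>\<^sub>M unif) {z. chain_step a x z \<in> A} \<partial>nu_law a)
      = (\<integral>\<^sup>+x. ennreal (1 - x) * indicator A x + ennreal x * emeasure (pi_law a) A \<partial>nu_law a)"
  proof (rule nn_integral_cong_AE)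
    show "AE x in nu_law a. emeasure (unif \<Otimes>\<^sub>M unif) {z. chain_step a x z \<in> A}
        = ennreal (1 - x) * indicator A x + ennreal x * emeasure (pi_law a) A"
      using AE_nu_law_unit by eventually_elim (rule step)
  qed
  also have "\<dots> = (\<integral>\<^sup>+x. ennreal (1 - x) * indicator A x \<partial>nu_law a)
      + (\<integral>\<^sup>+x. ennreal x * indicator UNIV x \<partial>nu_law a) * emeasure (pi_law a) A"
    by (simp add: nn_integral_add nn_integral_multc)
  also have "(\<integral>\<^sup>+x. ennreal x * indicator UNIV x \<partial>nu_law a) * emeasure (pi_law a) A
      = (\<integral>\<^sup>+x. ennreal x * indicator A x \<partial>nu_law a)"
    using nn_integral_nu_law_id[OF a, of UNIV] nn_integral_nu_law_id[OF a A] by (simp add: pi1)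
  also have "(\<integral>\<^sup>+x. ennreal (1 - x) * indicator A x \<partial>nu_law a) + \<dots>
      = (\<integral>\<^sup>+x. ennreal (1 - x) * indicator A x + ennreal x * indicator A x \<partial>nu_law a)"
    by (simp add: nn_integral_add)
  also have "\<dots> = (\<integral>\<^sup>+x. indicator A x \<partial>nu_law a)"
  proof (rule nn_integral_cong_AE)
    show "AE x in nu_law a. ennreal (1 - x) * indicator A x + ennreal x * indicator A x = indicator A x"
      using AE_nu_law_unit
      by eventually_elim (auto simp: indicator_def ennreal_plus[symmetric] simp del: ennreal_plus)
  qed
  also have "\<dots> = emeasure (nu_law a) A" by simp
  finally show ?thesis .
qed

section \<open>Two consequences of independence\<close>

context prob_space
begin

text \<open>The second Borel-Cantelli lemma.\<close>

lemma borel_cantelli_2: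
  fixes A :: "nat \<Rightarrow> 'a set"
  assumes indep: "indep_events A UNIV" and div: "\<not> summable (\<lambda>n. prob (A n))"
  shows "AE w in M. \<exists>\<^sub>\<infinity>n. w \<in> A n"
proof -
  have A [measurable]: "A n \<in> events" for n
    using indep by (auto simp: indep_events_def)
  have "indep_sets (\<lambda>n. {A n}) UNIV"
    using indep by (simp add: indep_events_def_alt)
  then have sets: "indep_sets (\<lambda>n. sigma_sets (space M) {A n}) UNIV"
    by (rule indep_sets_sigma) (simp add: Int_stable_def)
  have tail: "prob (\<Inter>m\<in>{n..}. space M - A m) = 0" for n
  proof -
    have "prob (\<Inter>m\<in>{n..}. space M - A m) \<le> exp (- (\<Sum>m=n..<n + k. prob (A m)))" if "k > 0" for k
    proof -
      have "prob (\<Inter>m\<in>{n..}. space M - A m) \<le> prob (\<Inter>m\<in>{n..<n + k}. space M - A m)"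
        using that by (intro finite_measure_mono sets.finite_INT) auto
      also have "\<dots> = (\<Prod>m=n..<n + k. prob (space M - A m))"
        using that by (intro indep_setsD[OF sets]) (auto intro: sigma_sets.intros)
      also have "\<dots> = (\<Prod>m=n..<n + k. 1 - prob (A m))"
        by (simp add: prob_compl)
      also have "\<dots> \<le> (\<Prod>m=n..<n + k. exp (- prob (A m)))"
        using exp_ge_add_one_self[of "- prob (A m)" for m] by (intro prod_mono) auto
      also have "\<dots> = exp (- (\<Sum>m=n..<n + k. prob (A m)))"
        by (simp add: exp_sum sum_negf[symmetric])
      finally show ?thesis .
    qed
    moreover have "filterlim (\<lambda>k. \<Sum>m=n..<n + k. prob (A m)) at_top sequentially"
    proof -
      have "\<not> summable (\<lambda>m. prob (A (m + n)))"
        using div summable_iff_shift[of "\<lambda>m. prob (A m)" n] by blast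
      then have "filterlim (\<lambda>k. \<Sum>m\<le>k. prob (A (m + n))) at_top sequentially"
        by (intro filterlim_partial_sums_at_top) auto
      then have "filterlim (\<lambda>k. \<Sum>m<Suc k. prob (A (m + n))) at_top sequentially"
        by (simp only: lessThan_Suc_atMost)
      then have "filterlim (\<lambda>k. \<Sum>m<k. prob (A (m + n))) at_top sequentially"
        using filterlim_sequentially_Suc[of "\<lambda>k. \<Sum>m<k. prob (A (m + n))" at_top] by blast
      also have "(\<lambda>k. \<Sum>m<k. prob (A (m + n))) = (\<lambda>k. \<Sum>m=n..<n + k. prob (A m))"
        using sum.shift_bounds_nat_ivl[of "\<lambda>m. prob (A m)" 0 n]
        by (simp add: add.commute atLeast0LessThan)
      finally show ?thesis .
    qed
    then have "(\<lambda>k. exp (- (\<Sum>m=n..<n + k. prob (A m)))) \<longlonglongrightarrow> 0"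
      by (intro filterlim_compose[OF exp_at_bot] filterlim_compose[OF filterlim_uminus_at_bot_at_top])
    ultimately have "prob (\<Inter>m\<in>{n..}. space M - A m) \<le> 0"
      by (intro LIMSEQ_le_const[where X = "\<lambda>k. exp (- (\<Sum>m=n..<n + k. prob (A m)))"]) (auto intro!: exI[of _ 1])
    then show ?thesis
      using measure_nonneg[of M] by (simp add: order_antisym)
  qed
  have "(\<Inter>m\<in>{n..}. space M - A m) \<in> null_sets M" for n
    using tail[of n] by (intro null_setsI) (auto simp: emeasure_eq_measure intro!: sets.countable_INT'')
  note null = this
  have "AE w in M. \<forall>n. w \<notin> (\<Inter>m\<in>{n..}. space M - A m)"
    unfolding AE_all_countable by (intro allI AE_not_in null)
  then show ?thesis
    using AE_space by eventually_elim (auto simp: INFM_nat_le)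
qed

lemma AE_neq_of_indep_atomless:
  fixes X Y :: "'a \<Rightarrow> real"
  assumes indep: "indep_pair borel X N Z" and f: "f \<in> borel_measurable N"
    and atomless: "\<And>x. emeasure (distr M borel X) {x} = 0"
  shows "AE w in M. X w \<noteq> f (Z w)"
proof -
  have [measurable]: "random_variable borel X" "random_variable N Z" "f \<in> borel_measurable N"
    using indep f by (auto simp: indep_pair_def)
  have [measurable]: "random_variable borel (\<lambda>w. f (Z w))" by measurable
  interpret X: prob_space "distr M borel X" by (rule prob_space_distr) simp
  interpret Y: prob_space "distr M borel (\<lambda>w. f (Z w))" by (rule prob_space_distr) simp
  have joint: "distr M borel (\<lambda>w. f (Z w)) \<Otimes>\<^sub>M distr M borel X = distr M (borel \<Otimes>\<^sub>M borel) (\<lambda>w. (f (Z w), X w))"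
  proof (rule pair_measure_eqI)
    fix A B assume "A \<in> sets (distr M borel (\<lambda>w. f (Z w)))" "B \<in> sets (distr M borel X)"
    then have [measurable]: "A \<in> sets borel" "B \<in> sets borel" by auto
    have eq: "(\<lambda>w. f (Z w)) -` A \<inter> space M = Z -` (f -` A \<inter> space N) \<inter> space M"
      using measurable_space[of Z M N] by auto
    have "f -` A \<inter> space N \<in> sets N"
      by measurable
    with eq have m1: "(\<lambda>w. f (Z w)) -` A \<inter> space M \<in> {Z -` B \<inter> space M |B. B \<in> sets N}"
      by (intro CollectI exI conjI)
    have m2: "X -` B \<inter> space M \<in> {X -` A \<inter> space M |A. A \<in> sets borel}"
      by (rule CollectI, rule exI[of _ B]) simp
    have "indep_set {X -` A \<inter> space M |A. A \<in> sets borel} {Z -` B \<inter> space M |B. B \<in> sets N}"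
      using indep by (simp add: indep_pair_def)
    then have "prob ((X -` B \<inter> space M) \<inter> ((\<lambda>w. f (Z w)) -` A \<inter> space M))
        = prob (X -` B \<inter> space M) * prob ((\<lambda>w. f (Z w)) -` A \<inter> space M)"
      by (rule indep_setD[OF _ m2 m1])
    then have "emeasure M ((\<lambda>w. f (Z w)) -` A \<inter> space M) * emeasure M (X -` B \<inter> space M)
        = emeasure M ((X -` B \<inter> space M) \<inter> ((\<lambda>w. f (Z w)) -` A \<inter> space M))"
      by (simp add: emeasure_eq_measure ennreal_mult[symmetric] mult.commute)
    also have "(X -` B \<inter> space M) \<inter> ((\<lambda>w. f (Z w)) -` A \<inter> space M) = (\<lambda>w. (f (Z w), X w)) -` (A \<times> B) \<inter> space M"
      by auto
    finally show "emeasure (distr M borel (\<lambda>w. f (Z w))) A * emeasure (distr M borel X) B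
        = emeasure (distr M (borel \<Otimes>\<^sub>M borel) (\<lambda>w. (f (Z w), X w))) (A \<times> B)"
      by (simp add: emeasure_distr)
  qed (auto simp: prob_space_imp_sigma_finite X.prob_space_axioms Y.prob_space_axioms cong: sets_pair_measure_cong)
  have "{p \<in> space (borel \<Otimes>\<^sub>M borel). fst p = (snd p :: real)} \<in> sets (borel \<Otimes>\<^sub>M borel)"
    by measurable
  then have diag: "{p :: real \<times> real. fst p = snd p} \<in> sets (borel \<Otimes>\<^sub>M borel)"
    by (simp add: space_pair_measure)
  have "emeasure M {w \<in> space M. X w = f (Z w)}
      = emeasure (distr M (borel \<Otimes>\<^sub>M borel) (\<lambda>w. (f (Z w), X w))) {p. fst p = snd p}"
    using diag by (subst emeasure_distr) (auto intro!: arg_cong[where f = "emeasure M"])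
  also have "\<dots> = (\<integral>\<^sup>+y. emeasure (distr M borel X) (Pair y -` {p. fst p = snd p}) \<partial>distr M borel (\<lambda>w. f (Z w)))"
    unfolding joint[symmetric] using diag
    by (intro X.emeasure_pair_measure_alt) (simp cong: sets_pair_measure_cong)
  also have "\<dots> = 0"
  proof -
    have "Pair y -` {p. fst p = snd p} = {y}" for y :: real by auto
    then show ?thesis by (simp add: atomless)
  qed
  finally have "{w \<in> space M. X w = f (Z w)} \<in> null_sets M"
    by (intro null_setsI) auto
  from AE_not_in[OF this] AE_space show ?thesis
    by eventually_elim auto
qed

end

section \<open>The chain as a function of its inputs\<close>

lemma chain_measurable:
  assumes a: "a > 0" and W0: "W0 \<in> borel_measurable N"
    and eps: "\<And>k. 1 \<le> k \<Longrightarrow> k \<le> n \<Longrightarrow> \<epsilon> (int k) \<in> borel_measurable N"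
  shows "chain a \<epsilon> W0 n \<in> borel_measurable N"
  using eps
proof (induction n)
  case 0
  then show ?case using W0 by simp
next
  case (Suc n)
  note [measurable] = pi_quantile_measurable[OF a]
  have [measurable]: "chain a \<epsilon> W0 n \<in> borel_measurable N"
    using Suc by simp
  have [measurable]: "\<epsilon> (int (Suc n)) \<in> N \<rightarrow>\<^sub>M borel \<Otimes>\<^sub>M borel"
    using Suc.prems[of "Suc n"] by (simp add: borel_prod)
  show ?case
    by (subst chain.simps(2)[abs_def]) measurable
qed

text \<open>The chain up to time \<open>n\<close> depends only on its initial value and the innovations \<open>1, \<dots>, n\<close>. The two
  chains may live on different spaces; this is used to view the chain as a function on a product space.\<close>

lemma chain_cong:
  assumes "W0 w = W0' w'" and "\<And>k. 1 \<le> k \<Longrightarrow> k \<le> n \<Longrightarrow> \<epsilon> (int k) w = \<epsilon>' (int k) w'"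
  shows "chain a \<epsilon> W0 n w = chain a \<epsilon>' W0' n w'"
  using assms(2)
proof (induction n)
  case (Suc n)
  then have "chain a \<epsilon> W0 n w = chain a \<epsilon>' W0' n w'" "\<epsilon> (int (Suc n)) w = \<epsilon>' (int (Suc n)) w'"
    by (simp_all del: of_nat_Suc)
  then show ?case by simp
qed (simp add: assms(1))

lemma chain_stays:
  assumes "\<And>k. m < k \<Longrightarrow> k \<le> m + n \<Longrightarrow> fst (\<epsilon> (int k) w) \<ge> chain a \<epsilon> W0 m w"
  shows "chain a \<epsilon> W0 (m + n) w = chain a \<epsilon> W0 m w"
  using assms
proof (induction n)
  case (Suc n)
  then show ?case using Suc.prems[of "m + Suc n"] by simp
qed simp

lemma chain_cases:
  "chain a \<epsilon> W0 n w = W0 w \<or> (\<exists>j. 1 \<le> j \<and> j \<le> n \<and> chain a \<epsilon> W0 n w = pi_quantile a (snd (\<epsilon> (int j) w)))"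
  by (induction n) (auto intro: le_SucI)

section \<open>Stationarity and independence of the next innovation\<close>

text \<open>The stationary chain together with its sources of randomness. The exponent \<open>p\<close> of the main
  result is \<open>a + 1\<close>.\<close>

locale driven_chain = prob_space M for M :: "'w measure" +
  fixes a :: real and \<epsilon> :: "int \<Rightarrow> 'w \<Rightarrow> real \<times> real" and W0 :: "'w \<Rightarrow> real"
  assumes a_pos: "a > 0"
    and innov: "uniform_innovations \<epsilon>"
    and W0_law: "distr M borel W0 = nu_law a"
    and W0_indep: "indep_pair borel W0 (PiM UNIV (\<lambda>_. borel)) (\<lambda>w i. \<epsilon> i w)"
begin

abbreviation W :: "nat \<Rightarrow> 'w \<Rightarrow> real" where
  "W \<equiv> chain a \<epsilon> W0"

lemma W0_measurable [measurable]: "random_variable borel W0"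
  using W0_indep by (simp add: indep_pair_def)

lemma indep_innov: "indep_vars (\<lambda>_. borel) \<epsilon> UNIV"
  using innov by (simp add: uniform_innovations_def)

lemma innov_borel_measurable [measurable]: "random_variable borel (\<epsilon> i)"
  using indep_innov by (simp add: indep_vars_def)

lemma innov_measurable [measurable]: "random_variable (borel \<Otimes>\<^sub>M borel) (\<epsilon> i)"
  unfolding borel_prod by simp

lemma distr_innov: "distr M (borel \<Otimes>\<^sub>M borel) (\<epsilon> i) = unif \<Otimes>\<^sub>M unif"
  using innov by (simp add: uniform_innovations_def uniform_square_eq borel_prod)

lemma W_measurable [measurable]: "random_variable borel (W n)"
  using a_pos by (intro chain_measurable) simp_all

text \<open>All the independent inputs of the chain as one family with a common value type: the initial
  value, padded by \<open>0\<close>, takes the place of the innovation with index \<open>0\<close>, which does not drive the chain.\<close>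

definition sources :: "int \<Rightarrow> 'w \<Rightarrow> real \<times> real" where
  "sources i w = (if i = 0 then (W0 w, 0) else \<epsilon> i w)"

lemma indep_sources: "indep_vars (\<lambda>_. borel) sources UNIV"
  unfolding indep_vars_def2
proof (intro conjI ballI)
  show rv: "random_variable borel (sources i)" for i
  proof (cases "i = 0")
    case True
    then have "sources i = (\<lambda>w. (W0 w, 0))" by (simp add: sources_def fun_eq_iff)
    then show ?thesis by (simp add: borel_prod[symmetric])
  next
    case False
    then have "sources i = \<epsilon> i" by (simp add: sources_def fun_eq_iff)
    then show ?thesis by simp
  qed
  show "indep_sets (\<lambda>i. {sources i -` A \<inter> space M |A. A \<in> sets borel}) UNIV"
  proof (rule indep_setsI)
    fix i show "{sources i -` A \<inter> space M |A. A \<in> sets borel} \<subseteq> events"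
      using rv by auto
  next
    fix F and J :: "int set"
    assume J: "J \<noteq> {}" "finite J" and "\<forall>j\<in>J. F j \<in> {sources j -` A \<inter> space M |A. A \<in> sets borel}"
    then obtain B where B: "\<And>j. j \<in> J \<Longrightarrow> B j \<in> sets borel" "\<And>j. j \<in> J \<Longrightarrow> F j = sources j -` B j \<inter> space M"
      by (simp add: Bex_def[symmetric] Ball_def[symmetric] mem_Collect_eq) metis
    define K where "K = J - {0}"
    have K: "finite K" "K \<subseteq> J" using J by (auto simp: K_def)
    have FK: "F j = \<epsilon> j -` B j \<inter> space M" if "j \<in> K" for j
      using that B(2)[of j] by (auto simp: K_def sources_def)
    have prodK: "prob (\<Inter>j\<in>K. F j) = (\<Prod>j\<in>K. prob (F j))" if "K \<noteq> {}"
    proof -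
      have "(\<Inter>j\<in>K. F j) = (\<Inter>j\<in>K. \<epsilon> j -` B j \<inter> space M)"
        using FK by (intro INF_cong) auto
      moreover have "prob (\<Inter>j\<in>K. \<epsilon> j -` B j \<inter> space M) = (\<Prod>j\<in>K. prob (\<epsilon> j -` B j \<inter> space M))"
        using B(1) K that by (intro indep_varsD[OF indep_innov]) auto
      ultimately show ?thesis using FK by simp
    qed
    show "prob (\<Inter>j\<in>J. F j) = (\<Prod>j\<in>J. prob (F j))"
    proof (cases "0 \<in> J")
      case False
      then have "K = J" by (auto simp: K_def)
      with prodK J show ?thesis by simp
    next
      case True
      show ?thesis
      proof (cases "K = {}")
        case True
        with \<open>0 \<in> J\<close> have "J = {0}" by (auto simp: K_def)
        then show ?thesis by simp
      next
        case False
        have "{x. (x, 0) \<in> B 0} \<in> sets (borel :: real measure)"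
          using measurable_sets_borel[of "\<lambda>x. (x, 0::real)" borel "B 0"] B(1)[OF \<open>0 \<in> J\<close>]
          by (simp add: vimage_def borel_prod[symmetric])
        moreover have "F 0 = W0 -` {x. (x, 0) \<in> B 0} \<inter> space M"
          using B(2)[OF \<open>0 \<in> J\<close>] by (auto simp: sources_def)
        ultimately have F0: "F 0 \<in> {W0 -` A \<inter> space M |A. A \<in> sets borel}"
          by (intro CollectI exI conjI)
        have "{\<omega> \<in> space (PiM UNIV (\<lambda>_. borel)). \<forall>j\<in>K. \<omega> j \<in> B j} \<in> sets (PiM UNIV (\<lambda>_ :: int. borel))"
        proof (intro sets.sets_Collect_finite_All' K(1) False)
          fix j assume "j \<in> K"
          then have "B j \<in> sets borel" using B(1) K by auto
          then show "{\<omega> \<in> space (PiM UNIV (\<lambda>_. borel)). \<omega> j \<in> B j} \<in> sets (PiM UNIV (\<lambda>_ :: int. borel))"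
            by measurable
        qed
        moreover have "(\<Inter>j\<in>K. F j) = (\<lambda>w i. \<epsilon> i w) -` {\<omega> \<in> space (PiM UNIV (\<lambda>_. borel)). \<forall>j\<in>K. \<omega> j \<in> B j} \<inter> space M"
          using FK False by (auto simp: space_PiM)
        ultimately have FK': "(\<Inter>j\<in>K. F j) \<in> {(\<lambda>w i. \<epsilon> i w) -` B \<inter> space M |B. B \<in> sets (PiM UNIV (\<lambda>_. borel))}"
          by (intro CollectI exI conjI)
        have "J = insert 0 K" "0 \<notin> K" using \<open>0 \<in> J\<close> by (auto simp: K_def)
        then have "prob (\<Inter>j\<in>J. F j) = prob (F 0 \<inter> (\<Inter>j\<in>K. F j))" by simp
        also have "\<dots> = prob (F 0) * prob (\<Inter>j\<in>K. F j)"
          using W0_indep unfolding indep_pair_def by (intro indep_setD[OF _ F0 FK']) simp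
        finally show ?thesis
          using prodK[OF False] \<open>J = insert 0 K\<close> \<open>0 \<notin> K\<close> K(1) by simp
      qed
    qed
  qed
qed

lemma W_eq_chain_sources:
  "W n w = chain a (\<lambda>i \<omega>. \<omega> i) (\<lambda>\<omega>. fst (\<omega> 0)) n (\<lambda>i\<in>{0..int n}. sources i w)"
  by (rule chain_cong) (simp_all add: sources_def)

lemma W_indep_next:
  assumes A: "A \<in> sets borel" and B: "B \<in> sets (borel \<Otimes>\<^sub>M borel)"
  shows "prob {w \<in> space M. W n w \<in> A \<and> \<epsilon> (int (Suc n)) w \<in> B}
    = prob {w \<in> space M. W n w \<in> A} * prob {w \<in> space M. \<epsilon> (int (Suc n)) w \<in> B}"
proof -
  define past where "past = (\<lambda>w. \<lambda>i\<in>{0..int n}. sources i w)"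
  define present where "present = (\<lambda>w. \<lambda>i\<in>{int (Suc n)}. sources i w)"
  define \<Phi> where "\<Phi> = chain a (\<lambda>i \<omega> :: int \<Rightarrow> real \<times> real. \<omega> i) (\<lambda>\<omega>. fst (\<omega> 0)) n"
  let ?P = "PiM {0..int n} (\<lambda>_. borel) :: (int \<Rightarrow> real \<times> real) measure"
  let ?Q = "PiM {int (Suc n)} (\<lambda>_. borel) :: (int \<Rightarrow> real \<times> real) measure"
  have indep: "indep_var ?P past ?Q present"
    unfolding past_def present_def by (rule indep_var_restrict[OF indep_sources]) auto
  have comp: "(\<lambda>\<omega>. \<omega> i) \<in> ?P \<rightarrow>\<^sub>M borel" if "i \<in> {0..int n}" for i
    using that by measurable
  have fst0: "(\<lambda>\<omega>. fst (\<omega> 0)) \<in> borel_measurable ?P"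
    using comp[of 0] by (auto simp: borel_prod[symmetric] intro: measurable_compose[OF _ measurable_fst])
  have \<Phi>: "\<Phi> \<in> borel_measurable ?P"
    unfolding \<Phi>_def using a_pos fst0 by (intro chain_measurable comp) auto
  have fut: "(\<lambda>\<omega>. \<omega> (int (Suc n))) \<in> ?Q \<rightarrow>\<^sub>M borel"
    by measurable
  have XA: "\<Phi> -` A \<inter> space ?P \<in> sets ?P"
    using \<Phi> A by (rule measurable_sets)
  have XB: "(\<lambda>\<omega>. \<omega> (int (Suc n))) -` B \<inter> space ?Q \<in> sets ?Q"
    using fut B by (intro measurable_sets[of _ _ borel]) (auto simp: borel_prod[symmetric])
  have past_space: "past w \<in> space ?P" "present w \<in> space ?Q" if "w \<in> space M" for w
    by (auto simp: past_def present_def space_PiM)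
  have W: "\<Phi> (past w) = W n w" for w
    by (simp add: \<Phi>_def past_def W_eq_chain_sources)
  have eps: "present w (int (Suc n)) = \<epsilon> (int (Suc n)) w" for w
    by (simp add: present_def sources_def)
  have "(\<lambda>w. (past w, present w)) -` ((\<Phi> -` A \<inter> space ?P) \<times> ((\<lambda>\<omega>. \<omega> (int (Suc n))) -` B \<inter> space ?Q)) \<inter> space M
      = {w \<in> space M. W n w \<in> A \<and> \<epsilon> (int (Suc n)) w \<in> B}"
    using past_space by (auto simp: W eps simp del: of_nat_Suc)
  moreover have "past -` (\<Phi> -` A \<inter> space ?P) \<inter> space M = {w \<in> space M. W n w \<in> A}"
    using past_space by (auto simp: W)
  moreover have "present -` ((\<lambda>\<omega>. \<omega> (int (Suc n))) -` B \<inter> space ?Q) \<inter> space M = {w \<in> space M. \<epsilon> (int (Suc n)) w \<in> B}"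
    using past_space by (auto simp: eps simp del: of_nat_Suc)
  ultimately show ?thesis
    using indep_varD[OF indep XA XB] by simp
qed

text \<open>Stationarity of the chain.\<close>

lemma distr_W: "distr M borel (W n) = nu_law a"
proof (induction n)
  case 0
  have "W 0 = W0" by (simp add: fun_eq_iff)
  then show ?case using W0_law by simp
next
  case (Suc n)
  interpret U: prob_space unif by (rule prob_space_unif)
  interpret UU: pair_prob_space unif unif ..
  note [measurable] = pi_quantile_measurable[OF a_pos] chain_step_measurable[OF a_pos]
  have joint: "nu_law a \<Otimes>\<^sub>M (unif \<Otimes>\<^sub>M unif)
      = distr M (borel \<Otimes>\<^sub>M (borel \<Otimes>\<^sub>M borel)) (\<lambda>w. (W n w, \<epsilon> (int (Suc n)) w))"
  proof (rule pair_measure_eqI)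
    fix A :: "real set" and B :: "(real \<times> real) set"
    assume "A \<in> sets (nu_law a)" "B \<in> sets (unif \<Otimes>\<^sub>M unif)"
    then have [measurable]: "A \<in> sets borel" "B \<in> sets (borel \<Otimes>\<^sub>M borel)"
      by (auto cong: sets_pair_measure_cong)
    have "emeasure (nu_law a) A * emeasure (unif \<Otimes>\<^sub>M unif) B
        = emeasure M {w \<in> space M. W n w \<in> A} * emeasure M {w \<in> space M. \<epsilon> (int (Suc n)) w \<in> B}"
      unfolding Suc.IH[symmetric] distr_innov[of "int (Suc n)", symmetric]
      by (subst (1 2) emeasure_distr) (auto simp: vimage_def Int_def conj_commute)
    also have "\<dots> = emeasure M {w \<in> space M. W n w \<in> A \<and> \<epsilon> (int (Suc n)) w \<in> B}"
      using W_indep_next[of A B n] by (simp add: emeasure_eq_measure ennreal_mult[symmetric])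
    also have "\<dots> = emeasure (distr M (borel \<Otimes>\<^sub>M (borel \<Otimes>\<^sub>M borel)) (\<lambda>w. (W n w, \<epsilon> (int (Suc n)) w))) (A \<times> B)"
      by (subst emeasure_distr) (auto simp: vimage_def Int_def conj_commute)
    finally show "emeasure (nu_law a) A * emeasure (unif \<Otimes>\<^sub>M unif) B
      = emeasure (distr M (borel \<Otimes>\<^sub>M (borel \<Otimes>\<^sub>M borel)) (\<lambda>w. (W n w, \<epsilon> (int (Suc n)) w))) (A \<times> B)" .
  qed (auto simp: prob_space_imp_sigma_finite prob_space_nu_law a_pos UU.prob_space_axioms cong: sets_pair_measure_cong)
  show ?case
  proof (rule measure_eqI)
    fix A assume "A \<in> sets (distr M borel (W (Suc n)))"
    then have [measurable]: "A \<in> sets borel" by simp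
    define S where "S = {p. (\<lambda>(x, z). chain_step a x z) p \<in> A}"
    have S: "S \<in> sets (borel \<Otimes>\<^sub>M (borel \<Otimes>\<^sub>M borel))"
      using measurable_sets[OF chain_step_measurable[OF a_pos], of A]
      by (simp add: S_def vimage_def space_pair_measure)
    have "emeasure (distr M borel (W (Suc n))) A
        = emeasure (distr M (borel \<Otimes>\<^sub>M (borel \<Otimes>\<^sub>M borel)) (\<lambda>w. (W n w, \<epsilon> (int (Suc n)) w))) S"
      using S by (subst (1 2) emeasure_distr) (auto simp: S_def chain_Suc_eq_step simp del: chain.simps(2)
          intro!: arg_cong[where f = "emeasure M"])
    also have "\<dots> = (\<integral>\<^sup>+x. emeasure (unif \<Otimes>\<^sub>M unif) (Pair x -` S) \<partial>nu_law a)"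
      unfolding joint[symmetric] using S by (intro UU.emeasure_pair_measure_alt) (simp cong: sets_pair_measure_cong)
    also have "\<dots> = emeasure (nu_law a) A"
      using nu_law_invariant[OF a_pos, of A] by (simp add: S_def vimage_def)
    finally show "emeasure (distr M borel (W (Suc n))) A = emeasure (nu_law a) A" .
  qed simp
qed

lemma prob_W_less:
  assumes "0 \<le> y" "y \<le> 1"
  shows "prob {w \<in> space M. W n w < y} \<le> y powr a"
proof -
  have "emeasure M {w \<in> space M. W n w < y} \<le> emeasure M (W n -` {..y} \<inter> space M)"
    by (intro emeasure_mono) auto
  also have "\<dots> = ennreal (y powr a)"
    using emeasure_nu_law_atMost[OF a_pos assms] by (simp add: distr_W[of n, symmetric] emeasure_distr)
  finally show ?thesis
    by (simp add: emeasure_eq_measure)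
qed

end

section \<open>Sojourns of the chain\<close>

lemma measure_unif_lessThan: "0 \<le> x \<Longrightarrow> x \<le> 1 \<Longrightarrow> measure unif {..<x} = x"
  by (simp add: measure_def emeasure_unif_lessThan del: emeasure_uniform_measure)

lemma measure_unif_atLeast: "0 \<le> x \<Longrightarrow> x \<le> 1 \<Longrightarrow> measure unif {x..} = 1 - x"
  by (simp add: measure_def emeasure_unif_atLeast del: emeasure_uniform_measure)

lemma measure_unif_atLeastAtMost: "0 \<le> x \<Longrightarrow> x \<le> 1 \<Longrightarrow> measure unif {0..x} = x"
  by (simp add: measure_def emeasure_unif_atMost del: emeasure_uniform_measure)

context driven_chain
begin

lemma prob_innov:
  assumes [measurable]: "A \<in> sets borel" "B \<in> sets borel"
  shows "prob {w \<in> space M. fst (\<epsilon> i w) \<in> A \<and> snd (\<epsilon> i w) \<in> B} = measure unif A * measure unif B"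
proof -
  interpret U: prob_space unif by (rule prob_space_unif)
  have "{w \<in> space M. fst (\<epsilon> i w) \<in> A \<and> snd (\<epsilon> i w) \<in> B} = \<epsilon> i -` (A \<times> B) \<inter> space M"
    by (auto simp: mem_Times_iff)
  then have "prob {w \<in> space M. fst (\<epsilon> i w) \<in> A \<and> snd (\<epsilon> i w) \<in> B}
      = measure (distr M (borel \<Otimes>\<^sub>M borel) (\<epsilon> i)) (A \<times> B)"
    by (simp add: measure_distr)
  also have "\<dots> = measure unif A * measure unif B"
    unfolding distr_innov
    by (simp add: measure_def U.emeasure_pair_measure_Times enn2real_mult del: emeasure_uniform_measure)
  finally show ?thesis .
qed

lemma prob_innov_fst:
  assumes "A \<in> sets borel"
  shows "prob {w \<in> space M. fst (\<epsilon> i w) \<in> A} = measure unif A"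
  using prob_innov[OF assms, of UNIV i] prob_space.prob_space[OF prob_space_unif] by simp

lemma indep_innov_pair:
  assumes ij: "i \<noteq> j" and A: "A \<in> sets (borel \<Otimes>\<^sub>M borel)" and B: "B \<in> sets (borel \<Otimes>\<^sub>M borel)"
  shows "prob {w \<in> space M. \<epsilon> i w \<in> A \<and> \<epsilon> j w \<in> B}
    = prob {w \<in> space M. \<epsilon> i w \<in> A} * prob {w \<in> space M. \<epsilon> j w \<in> B}"
proof -
  define F where "F = (\<lambda>k. if k = i then A else B)"
  have "prob (\<Inter>k\<in>{i, j}. \<epsilon> k -` F k \<inter> space M) = (\<Prod>k\<in>{i, j}. prob (\<epsilon> k -` F k \<inter> space M))"
    using A B by (intro indep_varsD[OF indep_innov]) (auto simp: F_def borel_prod[symmetric])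
  moreover have "(\<Inter>k\<in>{i, j}. \<epsilon> k -` F k \<inter> space M) = {w \<in> space M. \<epsilon> i w \<in> A \<and> \<epsilon> j w \<in> B}"
    using ij by (auto simp: F_def)
  moreover have "\<epsilon> i -` F i \<inter> space M = {w \<in> space M. \<epsilon> i w \<in> A}" "\<epsilon> j -` F j \<inter> space M = {w \<in> space M. \<epsilon> j w \<in> B}"
    using ij by (auto simp: F_def)
  ultimately show ?thesis using ij by simp
qed

text \<open>Long sojourns at low levels. At time \<open>n\<close> the wanted innovation is \<open>U\<^sub>n < y\<^sub>n\<close>, \<open>V\<^sub>n \<le> z\<^sub>n\<close>. It makes the
  chain jump into \<open>[0, x\<^sub>n]\<close> unless \<open>W\<^sub>n\<^sub>-\<^sub>1 < y\<^sub>n\<close>, an event of probability at most \<open>y\<^sub>n\<^sup>a\<close> that is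
  independent of the innovation at time \<open>n\<close>; after the jump the chain rests for \<open>L\<^sub>n\<close> steps unless one
  of the next \<open>L\<^sub>n\<close> variables \<open>U\<close> is below \<open>x\<^sub>n\<close>.\<close>

lemma frequently_long_sojourn:
  fixes x y z :: "nat \<Rightarrow> real" and L :: "nat \<Rightarrow> nat"
  assumes x: "\<And>n. 0 \<le> x n" "\<And>n. x n \<le> 1" and y: "\<And>n. 0 \<le> y n" "\<And>n. y n \<le> 1"
    and z: "\<And>n. 0 \<le> z n" "\<And>n. z n \<le> x n powr (a + 1)"
    and div: "\<not> summable (\<lambda>n. y n * z n)"
    and sum_low: "summable (\<lambda>n. y n * z n * y n powr a)"
    and sum_short: "summable (\<lambda>n. y n * z n * (real (L n) * x n))"
  shows "AE w in M. \<exists>\<^sub>F n in sequentially. 0 \<le> W n w \<and> W n w \<le> x n \<and> (\<forall>j\<le>L n. W (n + j) w = W n w)"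
proof -
  have z1: "z n \<le> 1" for n
    using z(2)[of n] powr_le1[of "a + 1" "x n"] x[of n] a_pos by simp
  define R where "R = (\<lambda>n. {..<y n} \<times> {0..z n})"
  have R [measurable]: "R n \<in> sets (borel \<Otimes>\<^sub>M borel)" for n
    by (simp add: R_def)
  have probR: "prob {w \<in> space M. \<epsilon> i w \<in> R n} = y n * z n" for i n
  proof -
    have "{w \<in> space M. \<epsilon> i w \<in> R n} = {w \<in> space M. fst (\<epsilon> i w) \<in> {..<y n} \<and> snd (\<epsilon> i w) \<in> {0..z n}}"
      by (auto simp: R_def mem_Times_iff)
    then show ?thesis
      using prob_innov[of "{..<y n}" "{0..z n}" i] y[of n] z(1)[of n] z1[of n]
      by (simp add: measure_unif_lessThan measure_unif_atLeastAtMost del: measure_uniform_measure)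
  qed
  define C where "C = (\<lambda>n. {w \<in> space M. \<epsilon> (int n) w \<in> R n})"
  have "indep_events C UNIV"
  proof (rule indep_eventsI)
    show "C n \<in> events" for n
      unfolding C_def by measurable
  next
    fix J :: "nat set" assume J: "finite J" "J \<noteq> {}"
    have C: "C n = \<epsilon> (int n) -` R (nat (int n)) \<inter> space M" for n
      by (auto simp: C_def)
    have "prob (\<Inter>i\<in>int ` J. \<epsilon> i -` R (nat i) \<inter> space M) = (\<Prod>i\<in>int ` J. prob (\<epsilon> i -` R (nat i) \<inter> space M))"
      using J R by (intro indep_varsD[OF indep_innov]) (auto simp: borel_prod[symmetric])
    then show "prob (\<Inter>n\<in>J. C n) = (\<Prod>n\<in>J. prob (C n))"
      by (simp only: C prod.reindex[OF inj_on_of_nat] image_image o_def)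
  qed
  then have often: "AE w in M. \<exists>\<^sub>\<infinity>n. w \<in> C n"
    using div probR by (intro borel_cantelli_2) (simp_all add: C_def)
  have "AE w in M. eventually (\<lambda>n. w \<in> space M - {w \<in> space M. W n w \<in> {..<y (Suc n)} \<and> \<epsilon> (int (Suc n)) w \<in> R (Suc n)}) sequentially"
  proof (rule borel_cantelli_AE1)
    have "prob {w \<in> space M. W n w \<in> {..<y (Suc n)} \<and> \<epsilon> (int (Suc n)) w \<in> R (Suc n)}
        \<le> y (Suc n) * z (Suc n) * y (Suc n) powr a" for n
    proof -
      have "prob {w \<in> space M. W n w \<in> {..<y (Suc n)} \<and> \<epsilon> (int (Suc n)) w \<in> R (Suc n)}
          = prob {w \<in> space M. W n w < y (Suc n)} * (y (Suc n) * z (Suc n))"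
        using W_indep_next[of "{..<y (Suc n)}" "R (Suc n)" n] by (simp add: probR del: of_nat_Suc)
      also have "\<dots> \<le> y (Suc n) powr a * (y (Suc n) * z (Suc n))"
        using y z(1) by (intro mult_right_mono prob_W_less mult_nonneg_nonneg)
      finally show ?thesis by (simp add: mult.commute)
    qed
    then show "summable (\<lambda>n. prob {w \<in> space M. W n w \<in> {..<y (Suc n)} \<and> \<epsilon> (int (Suc n)) w \<in> R (Suc n)})"
      using sum_low by (intro summable_comparison_test'[OF summable_Suc_iff[THEN iffD2, OF sum_low]]) simp
  qed (simp_all add: emeasure_eq_measure)
  then have not_low: "AE w in M. eventually (\<lambda>n. W n w \<ge> y (Suc n) \<or> \<epsilon> (int (Suc n)) w \<notin> R (Suc n)) sequentially"
    by eventually_elim (auto elim!: eventually_mono)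
  have "AE w in M. eventually (\<lambda>n. w \<in> space M -
      (\<Union>j\<in>{1..L n}. {w \<in> space M. \<epsilon> (int n) w \<in> R n \<and> \<epsilon> (int (n + j)) w \<in> {..<x n} \<times> UNIV})) sequentially"
  proof (rule borel_cantelli_AE1)
    have "prob (\<Union>j\<in>{1..L n}. {w \<in> space M. \<epsilon> (int n) w \<in> R n \<and> \<epsilon> (int (n + j)) w \<in> {..<x n} \<times> UNIV})
        \<le> y n * z n * (real (L n) * x n)" for n
    proof -
      have "prob {w \<in> space M. \<epsilon> (int n) w \<in> R n \<and> \<epsilon> (int (n + j)) w \<in> {..<x n} \<times> UNIV} = y n * z n * x n"
        if "j \<in> {1..L n}" for j
      proof -
        have "prob {w \<in> space M. \<epsilon> (int (n + j)) w \<in> {..<x n} \<times> UNIV} = x n"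
          using prob_innov_fst[of "{..<x n}" "int (n + j)"] x[of n]
          by (simp add: mem_Times_iff measure_unif_lessThan del: measure_uniform_measure)
        then show ?thesis
          using that probR[of "int n" n] by (subst indep_innov_pair) auto
      qed
      then have "(\<Sum>j\<in>{1..L n}. prob {w \<in> space M. \<epsilon> (int n) w \<in> R n \<and> \<epsilon> (int (n + j)) w \<in> {..<x n} \<times> UNIV})
          = y n * z n * (real (L n) * x n)"
        by simp
      then show ?thesis
        using finite_measure_subadditive_finite[of "{1..L n}"
            "\<lambda>j. {w \<in> space M. \<epsilon> (int n) w \<in> R n \<and> \<epsilon> (int (n + j)) w \<in> {..<x n} \<times> UNIV}"]
        by (simp add: image_subset_iff)
    qed
    then show "summable (\<lambda>n. prob (\<Union>j\<in>{1..L n}. {w \<in> space M. \<epsilon> (int n) w \<in> R n \<and> \<epsilon> (int (n + j)) w \<in> {..<x n} \<times> UNIV}))"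
      by (intro summable_comparison_test'[OF sum_short]) simp
  qed (simp_all add: emeasure_eq_measure)
  then have not_short: "AE w in M. eventually (\<lambda>n. \<epsilon> (int n) w \<in> R n \<longrightarrow> (\<forall>j\<in>{1..L n}. fst (\<epsilon> (int (n + j)) w) \<ge> x n)) sequentially"
    by eventually_elim (auto elim!: eventually_mono simp: mem_Times_iff not_less[symmetric])
  show ?thesis
    using often not_low not_short
  proof eventually_elim
    fix w
    assume C: "\<exists>\<^sub>\<infinity>n. w \<in> C n"
      and low: "eventually (\<lambda>n. W n w \<ge> y (Suc n) \<or> \<epsilon> (int (Suc n)) w \<notin> R (Suc n)) sequentially"
      and short: "eventually (\<lambda>n. \<epsilon> (int n) w \<in> R n \<longrightarrow> (\<forall>j\<in>{1..L n}. fst (\<epsilon> (int (n + j)) w) \<ge> x n)) sequentially"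
    \<comment> \<open>The shift by one is needed because the chain has no state before time \<open>0\<close>.\<close>
    have low': "eventually (\<lambda>n. n > 0 \<and> (W (n - 1) w \<ge> y n \<or> \<epsilon> (int n) w \<notin> R n)) sequentially"
      by (subst eventually_sequentially_Suc[symmetric]) (use low in \<open>simp del: of_nat_Suc\<close>)
    have good: "0 \<le> W n w \<and> W n w \<le> x n \<and> (\<forall>j\<le>L n. W (n + j) w = W n w)"
      if n: "n > 0" "W (n - 1) w \<ge> y n" "\<epsilon> (int n) w \<in> R n" "\<forall>j\<in>{1..L n}. fst (\<epsilon> (int (n + j)) w) \<ge> x n" for n
    proof -
      obtain m where m: "n = Suc m" using n(1) gr0_implies_Suc by blast
      define v where "v = snd (\<epsilon> (int n) w)"
      have v: "0 \<le> v" "v \<le> z n" "fst (\<epsilon> (int n) w) < y n"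
        using n(3) by (auto simp: R_def v_def mem_Times_iff)
      then have Wn: "W n w = pi_quantile a v"
        using n(2) by (simp add: m v_def)
      have "v \<le> cdf (pi_law a) (x n)"
        using v(2) z(2)[of n] x[of n] by (simp add: cdf_pi_law[OF a_pos])
      then have le: "W n w \<le> x n"
        using pi_quantile_le_iff[OF a_pos v(1) _ x(1)[of n]] v(2) z1[of n] by (simp add: Wn)
      have "W (n + j) w = W n w" if "j \<le> L n" for j
      proof (rule chain_stays)
        fix k assume "n < k" "k \<le> n + j"
        then have "k - n \<in> {1..L n}" "k = n + (k - n)" using that by auto
        then show "W n w \<le> fst (\<epsilon> (int k) w)"
          using n(4) le by (metis order_trans)
      qed
      moreover have "0 \<le> W n w"
        using v z1[of n] by (simp add: Wn pi_quantile_eq[OF a_pos])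
      ultimately show ?thesis using le by blast
    qed
    have "\<exists>\<^sub>F n in sequentially. w \<in> C n"
      using C by (simp add: cofinite_eq_sequentially)
    then show "\<exists>\<^sub>F n in sequentially. 0 \<le> W n w \<and> W n w \<le> x n \<and> (\<forall>j\<le>L n. W (n + j) w = W n w)"
    proof (rule frequently_rev_mp)
      show "\<forall>\<^sub>F n in sequentially. w \<in> C n \<longrightarrow> 0 \<le> W n w \<and> W n w \<le> x n \<and> (\<forall>j\<le>L n. W (n + j) w = W n w)"
        using low' short
      proof eventually_elim
        case (elim n)
        show ?case
        proof
          assume "w \<in> C n"
          then have "\<epsilon> (int n) w \<in> R n" by (simp add: C_def)
          then show "0 \<le> W n w \<and> W n w \<le> x n \<and> (\<forall>j\<le>L n. W (n + j) w = W n w)"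
            using elim by (intro good) auto
        qed
      qed
    qed
  qed
qed

end

section \<open>The meeting time\<close>

context driven_chain
begin

text \<open>The chain starts below \<open>r\<close> and does not move up to time \<open>n\<close>, because all \<open>U\<^sub>k\<close> are at least \<open>r\<close>.\<close>

lemma prob_initial_sojourn:
  assumes r: "0 \<le> r" "r \<le> 1"
  shows "prob {w \<in> space M. W0 w \<le> r \<and> (\<forall>k\<in>{1..n}. fst (\<epsilon> (int k) w) \<ge> r)} = r powr a * (1 - r) ^ n"
proof -
  define F where "F = (\<lambda>i :: int. (if i = 0 then {..r} else {r..}) \<times> (UNIV :: real set))"
  have "prob (\<Inter>i\<in>{0..int n}. sources i -` F i \<inter> space M) = (\<Prod>i\<in>{0..int n}. prob (sources i -` F i \<inter> space M))"
    by (intro indep_varsD[OF indep_sources]) (auto simp: F_def borel_prod[symmetric])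
  also have "{0..int n} = insert 0 {1..int n}"
    by auto
  also have "(\<Prod>i\<in>insert 0 {1..int n}. prob (sources i -` F i \<inter> space M))
      = prob (sources 0 -` F 0 \<inter> space M) * (\<Prod>i\<in>{1..int n}. prob (sources i -` F i \<inter> space M))"
    by simp
  also have "prob (sources 0 -` F 0 \<inter> space M) = r powr a"
  proof -
    have "sources 0 -` F 0 \<inter> space M = W0 -` {..r} \<inter> space M"
      by (auto simp: sources_def F_def)
    then have "prob (sources 0 -` F 0 \<inter> space M) = measure (nu_law a) {..r}"
      by (simp add: W0_law[symmetric] measure_distr)
    then show ?thesis
      using emeasure_nu_law_atMost[OF a_pos r] by (simp add: measure_def)
  qed
  also have "(\<Prod>i\<in>{1..int n}. prob (sources i -` F i \<inter> space M)) = (\<Prod>i\<in>{1..int n}. 1 - r)"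
  proof (rule prod.cong)
    fix i assume "i \<in> {1..int n}"
    then have "sources i -` F i \<inter> space M = {w \<in> space M. fst (\<epsilon> i w) \<in> {r..}}"
      by (auto simp: sources_def F_def mem_Times_iff)
    then show "prob (sources i -` F i \<inter> space M) = 1 - r"
      using prob_innov_fst[of "{r..}" i] r by (simp add: measure_unif_atLeast del: measure_uniform_measure)
  qed simp
  also have "(\<Inter>i\<in>insert 0 {1..int n}. sources i -` F i \<inter> space M)
      = {w \<in> space M. W0 w \<le> r \<and> (\<forall>k\<in>{1..n}. fst (\<epsilon> (int k) w) \<ge> r)}" (is "?l = ?r")
  proof (intro set_eqI iffI)
    fix w assume w: "w \<in> ?l"
    have "fst (\<epsilon> (int k) w) \<ge> r" if "k \<in> {1..n}" for k
    proof -
      have "int k \<in> insert 0 {1..int n}" using that by auto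
      then have "sources (int k) w \<in> F (int k)" using w by blast
      then show ?thesis using that by (auto simp: sources_def F_def mem_Times_iff)
    qed
    moreover have "w \<in> space M" "sources 0 w \<in> F 0" using w by auto
    ultimately show "w \<in> ?r" by (auto simp: sources_def F_def)
  next
    fix w assume w: "w \<in> ?r"
    have "fst (\<epsilon> i w) \<ge> r" if "i \<in> {1..int n}" for i
    proof -
      have "nat i \<in> {1..n}" "int (nat i) = i" using that by auto
      then show ?thesis using w by force
    qed
    then show "w \<in> ?l" using w by (auto simp: sources_def F_def mem_Times_iff)
  qed
  finally show ?thesis by simp
qed

lemma meeting_time_ge_iff:
  "meeting_time X Y w \<ge> enat (Suc n) \<longleftrightarrow> (\<forall>k\<le>n. X k w \<noteq> Y k w)"
  unfolding meeting_time_def le_Inf_iff by (auto simp: not_less_eq_eq) 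

text \<open>As long as the first chain rests at \<open>W\<^sub>0\<close>, the second one is either at its own initial value or at
  some quantile \<open>F\<^sup>-\<^sup>1(V\<^sub>j)\<close>; almost surely none of these equals \<open>W\<^sub>0\<close>. So the two chains have not met.\<close>

lemma prob_meeting_time_ge:
  assumes W0'_law: "distr M borel W0' = nu_law a"
    and W0'_indep: "indep_pair borel W0' (borel \<Otimes>\<^sub>M PiM UNIV (\<lambda>_. borel)) (\<lambda>w. (W0 w, \<lambda>i. \<epsilon> i w))"
  shows "exp (- 1) * real (Suc n) powr (- a)
    \<le> prob {w \<in> space M. meeting_time W (chain a \<epsilon> W0') w \<ge> enat (Suc n)}"
proof -
  have [measurable]: "random_variable borel W0'"
    using W0'_indep by (simp add: indep_pair_def)
  have [measurable]: "random_variable borel (chain a \<epsilon> W0' k)" for k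
    using a_pos by (intro chain_measurable) simp_all
  define r where "r = 1 / real (Suc n)"
  have r: "0 \<le> r" "r \<le> 1" by (simp_all add: r_def)
  have "AE w in M. W0' w \<noteq> fst (W0 w, \<lambda>i. \<epsilon> i w)"
    by (rule AE_neq_of_indep_atomless[OF W0'_indep]) (simp_all add: W0'_law emeasure_nu_law_singleton)
  then have neq0: "AE w in M. W0' w \<noteq> W0 w" by simp
  have "AE w in M. W0 w \<noteq> pi_quantile a (snd (\<epsilon> (int k) w))" for k
  proof (rule AE_neq_of_indep_atomless[OF W0_indep])
    have "(\<lambda>\<omega>. \<omega> (int k)) \<in> PiM UNIV (\<lambda>_. borel) \<rightarrow>\<^sub>M (borel :: (real \<times> real) measure)"
      by measurable
    moreover have "snd \<in> borel_measurable (borel :: (real \<times> real) measure)"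
      by (simp add: borel_prod[symmetric])
    ultimately have "(\<lambda>\<omega>. snd (\<omega> (int k))) \<in> borel_measurable (PiM UNIV (\<lambda>_. borel :: (real \<times> real) measure))"
      by (rule measurable_compose)
    then show "(\<lambda>\<omega>. pi_quantile a (snd (\<omega> (int k)))) \<in> borel_measurable (PiM UNIV (\<lambda>_. borel :: (real \<times> real) measure))"
      by (rule measurable_compose[OF _ pi_quantile_measurable[OF a_pos]])
  qed (simp add: W0_law emeasure_nu_law_singleton)
  then have neq: "AE w in M. \<forall>k. W0 w \<noteq> pi_quantile a (snd (\<epsilon> (int k) w))"
    by (simp add: AE_all_countable)
  \<comment> \<open>The choice of \<open>r\<close> keeps the probability of resting for \<open>n\<close> steps away from \<open>0\<close>.\<close>
  have "exp (- 1) \<le> (1 - r) ^ n"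
  proof (cases "n = 0")
    case False
    have "exp (- (1 / real n)) \<le> 1 - r"
    proof -
      have "1 - r = real n / real (Suc n)" "1 + 1 / real n = real (Suc n) / real n"
        using False by (simp_all add: r_def field_simps)
      then have "1 = (1 - r) * (1 + 1 / real n)"
        using False by simp
      also have "\<dots> \<le> (1 - r) * exp (1 / real n)"
        using r by (intro mult_left_mono exp_ge_add_one_self) auto
      finally show ?thesis by (simp add: exp_minus field_simps)
    qed
    then have "exp (- (1 / real n)) ^ n \<le> (1 - r) ^ n"
      by (intro power_mono) auto
    then show ?thesis
      using False by (simp add: exp_of_nat_mult[symmetric])
  qed simp
  then have "exp (- 1) * real (Suc n) powr (- a) \<le> r powr a * (1 - r) ^ n"
    by (simp add: r_def powr_divide powr_minus_divide mult.commute divide_right_mono)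
  also have "\<dots> = prob {w \<in> space M. W0 w \<le> r \<and> (\<forall>k\<in>{1..n}. fst (\<epsilon> (int k) w) \<ge> r)}"
    using prob_initial_sojourn[OF r] by simp
  also have "\<dots> \<le> prob {w \<in> space M. \<forall>k\<in>{..n}. W k w \<noteq> chain a \<epsilon> W0' k w}"
  proof (rule finite_measure_mono_AE)
    show "AE w in M. w \<in> {w \<in> space M. W0 w \<le> r \<and> (\<forall>k\<in>{1..n}. fst (\<epsilon> (int k) w) \<ge> r)}
        \<longrightarrow> w \<in> {w \<in> space M. \<forall>k\<in>{..n}. W k w \<noteq> chain a \<epsilon> W0' k w}"
      using neq0 neq
    proof (eventually_elim, clarsimp)
      fix w k
      assume w: "W0' w \<noteq> W0 w" "\<forall>k. W0 w \<noteq> pi_quantile a (snd (\<epsilon> (int k) w))" "W0 w \<le> r"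
        "\<forall>k\<in>{Suc 0..n}. r \<le> fst (\<epsilon> (int k) w)"
        and k: "k \<le> n" "W k w = chain a \<epsilon> W0' k w"
      have "W (0 + k) w = W 0 w"
        using w(3,4) k(1) by (intro chain_stays) (auto intro: order_trans)
      then have "chain a \<epsilon> W0' k w = W0 w" using k(2) by simp
      then show False
        using chain_cases[of a \<epsilon> W0' k w] w(1,2) by metis
    qed
    show "{w \<in> space M. \<forall>k\<in>{..n}. W k w \<noteq> chain a \<epsilon> W0' k w} \<in> events"
      by measurable
  qed
  finally show ?thesis
    by (simp add: meeting_time_ge_iff Ball_def)
qed

lemma meeting_time_series_diverges:
  assumes "distr M borel W0' = nu_law a"
    and "indep_pair borel W0' (borel \<Otimes>\<^sub>M PiM UNIV (\<lambda>_. borel)) (\<lambda>w. (W0 w, \<lambda>i. \<epsilon> i w))"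
  shows "\<not> summable (\<lambda>n. real (Suc n) powr (a - 1) *
    prob {w \<in> space M. meeting_time W (chain a \<epsilon> W0') w \<ge> enat (Suc n)})"
proof
  assume "summable (\<lambda>n. real (Suc n) powr (a - 1) *
    prob {w \<in> space M. meeting_time W (chain a \<epsilon> W0') w \<ge> enat (Suc n)})"
  then have "summable (\<lambda>n. exp (- 1) * inverse (real (Suc n)))"
  proof (rule summable_comparison_test'[where N = 0])
    fix n
    have "exp (- 1) * inverse (real (Suc n)) = real (Suc n) powr (a - 1) * (exp (- 1) * real (Suc n) powr (- a))"
      using powr_add[of "real (Suc n)" "a - 1" "- a"] by (simp add: powr_minus_divide inverse_eq_divide)
    also have "\<dots> \<le> real (Suc n) powr (a - 1) *
        prob {w \<in> space M. meeting_time W (chain a \<epsilon> W0') w \<ge> enat (Suc n)}"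
      by (intro mult_left_mono prob_meeting_time_ge assms) simp
    finally show "norm (exp (- 1) * inverse (real (Suc n))) \<le> real (Suc n) powr (a - 1) *
        prob {w \<in> space M. meeting_time W (chain a \<epsilon> W0') w \<ge> enat (Suc n)}"
      by simp
  qed
  then have "summable (\<lambda>n. inverse (real (Suc n)))"
    by (simp add: summable_cmult_iff)
  then have "summable (\<lambda>n. inverse (real n))"
    by (simp only: summable_Suc_iff[of "\<lambda>n. inverse (real n)"])
  then show False
    using not_summable_harmonic[where ?'a = real] by (simp add: inverse_eq_divide)
qed

end

section \<open>Gaussian sequences\<close>

context prob_space
begin

text \<open>The even moments of a centred Gaussian variable in terms of its variance. Degenerate laws are
  included: they are point masses at \<open>0\<close>, and the case \<open>k = 0\<close> of the formula reads \<open>1 = 1\<close>.\<close>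

lemma gaussian_variable_moments:
  assumes X: "gaussian_variable X" and mean: "expectation X = 0"
  shows "integrable M (\<lambda>w. X w ^ (2 * k))"
    and "expectation (\<lambda>w. X w ^ (2 * k)) = fact (2 * k) / (2 ^ k * fact k) * expectation (\<lambda>w. (X w)\<^sup>2) ^ k"
proof -
  have [measurable]: "random_variable borel X"
    using X by (simp add: gaussian_variable_def)
  obtain \<mu> \<sigma> where law: "\<sigma> = 0 \<and> distr M borel X = return borel \<mu> \<or>
      \<sigma> > 0 \<and> distr M borel X = density lborel (\<lambda>x. ennreal (normal_density \<mu> \<sigma> x))"
    using X by (auto simp: gaussian_variable_def)
  have "integrable M (\<lambda>w. X w ^ (2 * k)) \<and>
    expectation (\<lambda>w. X w ^ (2 * k)) = fact (2 * k) / (2 ^ k * fact k) * expectation (\<lambda>w. (X w)\<^sup>2) ^ k"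
    using law
  proof
    assume "\<sigma> = 0 \<and> distr M borel X = return borel \<mu>"
    then have D: "distr M borel X = return borel \<mu>" by simp
    have "AE x in distr M borel X. x = \<mu>"
      unfolding D by (subst AE_return) auto
    then have AE: "AE w in M. X w = \<mu>"
      by (simp add: AE_distr_iff)
    then have "expectation X = expectation (\<lambda>_. \<mu>)"
      by (intro integral_cong_AE) auto
    then have "\<mu> = 0" using mean by (simp add: prob_space)
    have "AE w in M. X w ^ (2 * j) = (if j = 0 then 1 else 0)" for j
      using AE by eventually_elim (use \<open>\<mu> = 0\<close> in auto)
    then have "integrable M (\<lambda>w. X w ^ (2 * j)) \<longleftrightarrow> integrable M (\<lambda>w. if j = 0 then 1 else 0 :: real)"
      "expectation (\<lambda>w. X w ^ (2 * j)) = expectation (\<lambda>w. if j = 0 then 1 else 0)" for j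
      by (intro integrable_cong_AE integral_cong_AE; simp)+
    from this[of k] this[of 1] show ?thesis
      by (auto simp: prob_space)
  next
    assume "\<sigma> > 0 \<and> distr M borel X = density lborel (\<lambda>x. ennreal (normal_density \<mu> \<sigma> x))"
    then have \<sigma>: "\<sigma> > 0" and D: "distr M borel X = density lborel (\<lambda>x. ennreal (normal_density \<mu> \<sigma> x))"
      by auto
    have int: "expectation (\<lambda>w. h (X w)) = (\<integral>x. normal_density \<mu> \<sigma> x * h x \<partial>lborel)"
      and intble: "integrable M (\<lambda>w. h (X w)) \<longleftrightarrow> integrable lborel (\<lambda>x. normal_density \<mu> \<sigma> x * h x)"
      if [measurable]: "h \<in> borel_measurable borel" for h :: "real \<Rightarrow> real"
    proof -
      have "expectation (\<lambda>w. h (X w)) = integral\<^sup>L (distr M borel X) h"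
        by (simp add: integral_distr)
      also have "\<dots> = (\<integral>x. normal_density \<mu> \<sigma> x * h x \<partial>lborel)"
        unfolding D by (subst integral_density) auto
      finally show "expectation (\<lambda>w. h (X w)) = (\<integral>x. normal_density \<mu> \<sigma> x * h x \<partial>lborel)" .
      have "integrable M (\<lambda>w. h (X w)) \<longleftrightarrow> integrable (distr M borel X) h"
        by (simp add: integrable_distr_eq)
      also have "\<dots> \<longleftrightarrow> integrable lborel (\<lambda>x. normal_density \<mu> \<sigma> x * h x)"
        unfolding D by (subst integrable_density) auto
      finally show "integrable M (\<lambda>w. h (X w)) \<longleftrightarrow> integrable lborel (\<lambda>x. normal_density \<mu> \<sigma> x * h x)" .
    qed
    have "\<mu> = 0"
      using int[of "\<lambda>x. x"] mean integral_normal_moment_nz_1[OF \<sigma>, of \<mu>] by simp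
    have mom: "expectation (\<lambda>w. X w ^ (2 * j)) = fact (2 * j) / ((2 / \<sigma>\<^sup>2) ^ j * fact j)" for j
      using int[of "\<lambda>x. x ^ (2 * j)"] integral_normal_moment_even[OF \<sigma>, of 0 j] \<open>\<mu> = 0\<close> by simp
    have "integrable M (\<lambda>w. X w ^ (2 * k))"
      using intble[of "\<lambda>x. x ^ (2 * k)"] normal_moment_even[OF \<sigma>, of 0 k] \<open>\<mu> = 0\<close>
      by (auto intro: integrable.intros)
    moreover have "expectation (\<lambda>w. (X w)\<^sup>2) = \<sigma>\<^sup>2"
      using mom[of 1] by (simp add: fact_numeral)
    ultimately show ?thesis
      using mom[of k] by (simp add: power_divide)
  qed
  then show "integrable M (\<lambda>w. X w ^ (2 * k))"
    and "expectation (\<lambda>w. X w ^ (2 * k)) = fact (2 * k) / (2 ^ k * fact k) * expectation (\<lambda>w. (X w)\<^sup>2) ^ k"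
    by auto
qed

text \<open>Markov's inequality for the moment of order \<open>2 k\<close>. As \<open>k\<close> is arbitrary, this polynomial bound
  is as good here as an exponential one.\<close>

lemma gaussian_variable_tail:
  assumes X: "gaussian_variable X" and mean: "expectation X = 0"
    and v: "expectation (\<lambda>w. (X w)\<^sup>2) \<le> v" and t: "t > 0"
  shows "prob {w \<in> space M. \<bar>X w\<bar> \<ge> t} \<le> fact (2 * k) / (2 ^ k * fact k) * (v / t\<^sup>2) ^ k"
proof -
  have [measurable]: "random_variable borel X"
    using X by (simp add: gaussian_variable_def)
  have "{w \<in> space M. \<bar>X w\<bar> \<ge> t} \<subseteq> {w \<in> space M. X w ^ (2 * k) \<ge> t ^ (2 * k)}"
    using t power_mono[of t "\<bar>X w\<bar>" "2 * k" for w] by (auto simp: power_even_abs)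
  then have "prob {w \<in> space M. \<bar>X w\<bar> \<ge> t} \<le> prob {w \<in> space M. X w ^ (2 * k) \<ge> t ^ (2 * k)}"
    by (intro finite_measure_mono) auto
  also have "\<dots> \<le> expectation (\<lambda>w. X w ^ (2 * k)) / t ^ (2 * k)"
    using t by (intro integral_Markov_inequality_measure[where A = "{}"] gaussian_variable_moments[OF X mean]) auto
  also have "\<dots> = fact (2 * k) / (2 ^ k * fact k) * (expectation (\<lambda>w. (X w)\<^sup>2) / t\<^sup>2) ^ k"
    unfolding gaussian_variable_moments(2)[OF X mean] by (simp add: power_mult power_divide)
  also have "\<dots> \<le> fact (2 * k) / (2 ^ k * fact k) * (v / t\<^sup>2) ^ k"
    using v t by (intro mult_left_mono power_mono divide_right_mono) auto
  finally show ?thesis .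
qed

end

text \<open>The Gaussian sequence of the main result, with no reference to the chain.\<close>

locale gaussian_noise = prob_space M for M :: "'w measure" +
  fixes g :: "int \<Rightarrow> 'w \<Rightarrow> real"
  assumes stationary: "stationary_sequence g" and gaussian: "gaussian_sequence g"
    and centered: "centered_sequence g" and covariances: "convergent_covariances g"
begin

lemma g_measurable [measurable]: "random_variable borel (g k)"
  using stationary by (simp add: stationary_sequence_def)

lemma gaussian_sum: "finite J \<Longrightarrow> gaussian_variable (\<lambda>w. \<Sum>k\<in>J. g k w)"
  using gaussian[unfolded gaussian_sequence_def, rule_format, of J "\<lambda>_. 1"] by simp

lemma integrable_g [simp]: "integrable M (g k)" and expectation_g [simp]: "expectation (g k) = 0"
  using centered by (auto simp: centered_sequence_def)

lemma integrable_g_square: "integrable M (\<lambda>w. (g k w)\<^sup>2)"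
  using gaussian_variable_moments(1)[of "g k" 1] gaussian_sum[of "{k}"] by simp

lemma integrable_g_times [simp]: "integrable M (\<lambda>w. g i w * g j w)"
proof (rule Bochner_Integration.integrable_bound)
  show "integrable M (\<lambda>w. (g i w)\<^sup>2 + (g j w)\<^sup>2)"
    by (intro Bochner_Integration.integrable_add integrable_g_square)
  show "AE w in M. norm (g i w * g j w) \<le> norm ((g i w)\<^sup>2 + (g j w)\<^sup>2)"
  proof (rule AE_I2)
    fix w
    have "\<bar>g i w * g j w\<bar> \<le> (g i w)\<^sup>2 + (g j w)\<^sup>2"
      using sum_squares_bound[of "\<bar>g i w\<bar>" "\<bar>g j w\<bar>"] mult_nonneg_nonneg[of "\<bar>g i w\<bar>" "\<bar>g j w\<bar>"]
      unfolding abs_mult power2_abs by linarith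
    then show "norm (g i w * g j w) \<le> norm ((g i w)\<^sup>2 + (g j w)\<^sup>2)" by simp
  qed
qed simp

text \<open>The autocovariance at nonnegative lags; the sequence being centred, no means appear.\<close>

definition \<gamma> :: "nat \<Rightarrow> real" where
  "\<gamma> k = expectation (\<lambda>w. g 0 w * g (int k) w)"

lemma expectation_g_times: "expectation (\<lambda>w. g i w * g (i + int k) w) = \<gamma> k"
proof -
  let ?P = "PiM UNIV (\<lambda>_. borel) :: (int \<Rightarrow> real) measure"
  have meas: "(\<lambda>w k. g (k + h) w) \<in> M \<rightarrow>\<^sub>M ?P" for h
    by (rule measurable_PiM_single') (auto simp: space_PiM)
  have h: "(\<lambda>\<omega>. \<omega> 0 * \<omega> (int k)) \<in> borel_measurable ?P"
    by measurable
  have "expectation (\<lambda>w. g i w * g (i + int k) w) = integral\<^sup>L (distr M ?P (\<lambda>w k. g (k + i) w)) (\<lambda>\<omega>. \<omega> 0 * \<omega> (int k))"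
    using integral_distr[OF meas h, of i] by (simp add: add.commute)
  also have "distr M ?P (\<lambda>w k. g (k + i) w) = distr M ?P (\<lambda>w k. g (k + 0) w)"
    using stationary by (simp add: stationary_sequence_def)
  also have "integral\<^sup>L \<dots> (\<lambda>\<omega>. \<omega> 0 * \<omega> (int k)) = \<gamma> k"
    using integral_distr[OF meas h, of 0] by (simp add: \<gamma>_def)
  finally show ?thesis .
qed

text \<open>Partial sums over \<open>L\<close> consecutive indices have variance \<open>O(L)\<close>: lengthening the block from \<open>L\<close> to
  \<open>L + 1\<close> adds \<open>\<gamma> 0 + 2 (\<gamma> 1 + \<dots> + \<gamma> L)\<close>, which is bounded. Absolute convergence is not needed.\<close>

lemma increment_variance_linear:
  obtains C where "C > 0" "\<And>n L. expectation (\<lambda>w. (\<Sum>k=Suc n..n + L. g (int k) w)\<^sup>2) \<le> C * real L"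
proof -
  have "summable \<gamma>"
    using covariances by (simp add: convergent_covariances_def covariance_def \<gamma>_def[abs_def])
  then have "Bseq (\<lambda>m. \<Sum>j<m. \<gamma> j)"
    by (intro convergent_imp_Bseq) (simp add: summable_iff_convergent)
  then obtain B where B: "B > 0" "\<And>m. \<bar>\<Sum>j<m. \<gamma> j\<bar> \<le> B"
    unfolding Bseq_def by auto
  have "expectation (\<lambda>w. (\<Sum>k=Suc n..n + L. g (int k) w)\<^sup>2) \<le> (5 * B) * real L" for n L
  proof (induction L)
    case (Suc L)
    define S where "S = (\<lambda>w. \<Sum>k=Suc n..n + L. g (int k) w)"
    define X where "X = g (int (Suc (n + L)))"
    have cross: "expectation (\<lambda>w. S w * X w) = (\<Sum>j<Suc L. \<gamma> j) - \<gamma> 0"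
    proof -
      have "expectation (\<lambda>w. S w * X w) = (\<Sum>k=Suc n..n + L. expectation (\<lambda>w. g (int k) w * X w))"
        unfolding S_def X_def sum_distrib_right by (rule Bochner_Integration.integral_sum) simp
      also have "\<dots> = (\<Sum>k=Suc n..n + L. \<gamma> (Suc (n + L) - k))"
      proof (rule sum.cong)
        fix k assume "k \<in> {Suc n..n + L}"
        then have "int (Suc (n + L)) = int k + int (Suc (n + L) - k)" by auto
        then show "expectation (\<lambda>w. g (int k) w * X w) = \<gamma> (Suc (n + L) - k)"
          unfolding X_def by (metis expectation_g_times)
      qed simp
      also have "\<dots> = (\<Sum>j=1..L. \<gamma> j)"
        by (rule sum.reindex_bij_witness[of _ "\<lambda>j. Suc (n + L) - j" "\<lambda>k. Suc (n + L) - k"]) auto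
      also have "\<dots> = (\<Sum>j<Suc L. \<gamma> j) - \<gamma> 0"
        by (simp add: sum.atLeast1_atMost_eq sum.lessThan_Suc_shift del: sum.lessThan_Suc)
      finally show ?thesis .
    qed
    have sq: "integrable M (\<lambda>w. (S w)\<^sup>2)"
      unfolding S_def power2_eq_square sum_product by auto
    have prod: "integrable M (\<lambda>w. S w * X w)"
      unfolding S_def X_def sum_distrib_right by auto
    have X2: "expectation (\<lambda>w. (X w)\<^sup>2) = \<gamma> 0" "integrable M (\<lambda>w. (X w)\<^sup>2)"
      using expectation_g_times[of "int (Suc (n + L))" 0] by (auto simp: X_def power2_eq_square simp del: of_nat_Suc)
    have "(\<Sum>k=Suc n..n + Suc L. g (int k) w) = S w + X w" for w
      by (simp add: S_def X_def)
    then have "expectation (\<lambda>w. (\<Sum>k=Suc n..n + Suc L. g (int k) w)\<^sup>2)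
        = expectation (\<lambda>w. (S w)\<^sup>2 + 2 * (S w * X w) + (X w)\<^sup>2)"
      by (simp add: power2_sum algebra_simps)
    also have "\<dots> = expectation (\<lambda>w. (S w)\<^sup>2) + 2 * ((\<Sum>j<Suc L. \<gamma> j) - \<gamma> 0) + \<gamma> 0"
      using sq prod X2 cross by simp
    also have "\<dots> \<le> 5 * B * real L + 5 * B"
      using Suc B(2)[of "Suc L"] B(2)[of 1] unfolding S_def by (simp add: abs_le_iff)
    finally show ?case by (simp add: algebra_simps)
  qed simp
  with that[of "5 * B"] B(1) show ?thesis by simp
qed

lemma eventually_increment_small:
  fixes L :: "nat \<Rightarrow> nat"
  assumes L: "\<And>n. L n > 0" and sum: "summable (\<lambda>n. 1 / real (L n) ^ K)" and \<delta>: "\<delta> > 0"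
  shows "AE w in M. eventually (\<lambda>n. \<bar>\<Sum>k=Suc n..n + L n. g (int k) w\<bar> < \<delta> * real (L n)) sequentially"
proof -
  obtain C where C: "C > 0" "\<And>n L. expectation (\<lambda>w. (\<Sum>k=Suc n..n + L. g (int k) w)\<^sup>2) \<le> C * real L"
    using increment_variance_linear by blast
  define c where "c = fact (2 * K) / (2 ^ K * fact K) * (C / \<delta>\<^sup>2) ^ K"
  define E where "E = (\<lambda>n. {w \<in> space M. \<bar>\<Sum>k=Suc n..n + L n. g (int k) w\<bar> \<ge> \<delta> * real (L n)})"
  have E: "E n \<in> events" for n
    unfolding E_def by measurable
  have "prob (E n) \<le> c * (1 / real (L n) ^ K)" for n
  proof -
    have "gaussian_variable (\<lambda>w. \<Sum>k\<in>int ` {Suc n..n + L n}. g k w)"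
      by (rule gaussian_sum) simp
    then have "gaussian_variable (\<lambda>w. \<Sum>k=Suc n..n + L n. g (int k) w)"
      by (simp add: sum.reindex)
    moreover have "expectation (\<lambda>w. \<Sum>k=Suc n..n + L n. g (int k) w) = 0"
      by (subst Bochner_Integration.integral_sum) auto
    ultimately have "prob (E n) \<le> fact (2 * K) / (2 ^ K * fact K) * (C * real (L n) / (\<delta> * real (L n))\<^sup>2) ^ K"
      unfolding E_def using C(2)[of n "L n"] \<delta> L[of n] by (intro gaussian_variable_tail) auto
    also have "C * real (L n) / (\<delta> * real (L n))\<^sup>2 = C / \<delta>\<^sup>2 * (1 / real (L n))"
      using L[of n] by (simp add: power2_eq_square field_simps)
    also have "fact (2 * K) / (2 ^ K * fact K) * (C / \<delta>\<^sup>2 * (1 / real (L n))) ^ K = c * (1 / real (L n) ^ K)"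
      by (simp only: c_def power_mult_distrib power_one_over mult.assoc)
    finally show ?thesis .
  qed
  then have "summable (\<lambda>n. prob (E n))"
    by (intro summable_comparison_test'[OF summable_mult[OF sum, of c]]) simp
  then have "AE w in M. eventually (\<lambda>n. w \<in> space M - E n) sequentially"
    using E by (intro borel_cantelli_AE1) (auto simp: emeasure_eq_measure)
  then show ?thesis
    by eventually_elim (auto simp: E_def not_le elim!: eventually_mono)
qed

end

section \<open>The time scale of the sojourns\<close>

text \<open>The normalising sequence \<open>b\<^sub>n = (n log n)\<^bsup>1/p\<^esup>\<close>.\<close>

definition rate :: "real \<Rightarrow> nat \<Rightarrow> real" where
  "rate p n = (real n * ln (real n)) powr (1 / p)"

text \<open>The integer length of the sojourns considered. It exceeds \<open>rate p n\<close> by at most \<open>1\<close>, and it is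
  positive also for \<open>n \<le> 1\<close>, where \<open>rate p n = 0\<close>.\<close>

definition sojourn_length :: "real \<Rightarrow> nat \<Rightarrow> nat" where
  "sojourn_length p n = Suc (nat \<lfloor>rate p n\<rfloor>)"

lemma ln_ge_one: "n \<ge> 3 \<Longrightarrow> 1 \<le> ln (real n)"
  using exp_le by (subst ln_ge_iff) (auto intro: order_trans)

lemma n_ln_n_ge: "n \<ge> 3 \<Longrightarrow> real n \<le> real n * ln (real n)"
  using ln_ge_one[of n] mult_left_mono[of 1 "ln (real n)" "real n"] by simp

lemma rate_nonneg: "rate p n \<ge> 0"
  by (simp add: rate_def)

lemma rate_less_sojourn_length: "rate p n < real (sojourn_length p n)"
  using rate_nonneg[of p n] unfolding sojourn_length_def by linarith

lemma sojourn_length_le: "real (sojourn_length p n) \<le> rate p n + 1"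
  using rate_nonneg[of p n] unfolding sojourn_length_def by linarith

lemma rate_ge_powr: "p > 0 \<Longrightarrow> n \<ge> 3 \<Longrightarrow> real n powr (1 / p) \<le> rate p n"
  unfolding rate_def using n_ln_n_ge[of n] by (intro powr_mono2) auto

lemma rate_ge_one: "p > 0 \<Longrightarrow> n \<ge> 3 \<Longrightarrow> 1 \<le> rate p n"
  by (rule order_trans[OF ge_one_powr_ge_zero rate_ge_powr]) auto

lemma summable_inverse_sojourn_length_power:
  assumes p: "p > 0"
  shows "summable (\<lambda>n. 1 / real (sojourn_length p n) ^ nat \<lceil>2 * p\<rceil>)"
proof (rule summable_comparison_test'[where N = 3])
  show "summable (\<lambda>n. inverse (real n ^ 2))"
    by (rule inverse_power_summable) simp
next
  fix n :: nat assume n: "n \<ge> 3"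
  define K where "K = nat \<lceil>2 * p\<rceil>"
  have K: "real K \<ge> 2 * p" unfolding K_def by linarith
  have "real n ^ 2 = real n powr 2"
    using n by (simp add: powr_numeral)
  also have "\<dots> \<le> real n powr (1 / p * real K)"
    using n K p by (intro powr_mono) (simp_all add: field_simps)
  also have "\<dots> = (real n powr (1 / p)) ^ K"
    using n by (subst powr_powr[symmetric], subst powr_realpow) auto
  also have "\<dots> \<le> real (sojourn_length p n) ^ K"
    using rate_ge_powr[OF p n] rate_less_sojourn_length[of p n] by (intro power_mono) auto
  finally have "1 / real (sojourn_length p n) ^ K \<le> 1 / real n ^ 2"
    using n by (intro divide_left_mono mult_pos_pos) (auto simp: sojourn_length_def)
  then show "norm (1 / real (sojourn_length p n) ^ nat \<lceil>2 * p\<rceil>) \<le> inverse (real n ^ 2)"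
    by (simp add: K_def inverse_eq_divide)
qed

lemma rate_after_sojourn_le:
  assumes p: "p \<ge> 2" and n: "n \<ge> 3"
  shows "rate p (n + sojourn_length p n) \<le> 6 * rate p n"
proof -
  define N where "N = n + sojourn_length p n"
  have "real n * ln (real n) \<le> real n * real n"
    using n ln_le_minus_one[of "real n"] by (intro mult_left_mono) auto
  also have "\<dots> = real n powr 2"
    using n by (simp add: powr_numeral power2_eq_square)
  also have "\<dots> \<le> real n powr p"
    using n p by (intro powr_mono) auto
  finally have "rate p n \<le> (real n powr p) powr (1 / p)"
    unfolding rate_def using p n by (intro powr_mono2) auto
  also have "\<dots> = real n"
    using p n by (simp add: powr_powr)
  finally have N: "real N \<le> 3 * real n"
    using sojourn_length_le[of p n] n by (simp add: N_def)
  have N3: "N \<ge> 3" using n by (simp add: N_def)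
  have "ln (real N) \<le> ln (3 * real n)"
    using N N3 by simp
  also have "\<dots> \<le> 2 * ln (real n)"
    using n by (simp add: ln_mult)
  finally have "real N * ln (real N) \<le> (3 * real n) * (2 * ln (real n))"
    using N N3 n by (intro mult_mono) auto
  then have "rate p N \<le> (6 * (real n * ln (real n))) powr (1 / p)"
    unfolding rate_def using N3 p by (intro powr_mono2) auto
  also have "\<dots> = 6 powr (1 / p) * rate p n"
    using n by (simp add: rate_def powr_mult)
  also have "\<dots> \<le> 6 powr 1 * rate p n"
    using p by (intro mult_right_mono powr_mono rate_nonneg) auto
  finally show ?thesis by (simp add: N_def)
qed

text \<open>If \<open>\<bar>D n\<bar>\<close> were eventually below \<open>\<kappa> b\<^sub>n / 7\<close>, the increments of \<open>D\<close> over sojourn lengths \<open>L\<^sub>n\<close> would be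
  below \<open>(1 + 6) \<kappa> b\<^sub>n / 7 \<le> \<kappa> L\<^sub>n\<close>, since \<open>b\<close> grows at most by the factor \<open>6\<close> between \<open>n\<close> and \<open>n + L\<^sub>n\<close>.\<close>

lemma limsup_pos_of_large_increments:
  fixes D :: "nat \<Rightarrow> real"
  assumes p: "p \<ge> 2" and \<kappa>: "\<kappa> > 0"
    and large: "\<exists>\<^sub>F n in sequentially. \<bar>D (n + sojourn_length p n) - D n\<bar> \<ge> \<kappa> * real (sojourn_length p n)"
  shows "limsup (\<lambda>n. ereal ((real n * ln (real n)) powr (- 1 / p) * \<bar>D n\<bar>)) > 0"
proof (rule ccontr)
  assume "\<not> ?thesis"
  then have "limsup (\<lambda>n. ereal ((real n * ln (real n)) powr (- 1 / p) * \<bar>D n\<bar>)) < ereal (\<kappa> / 7)"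
    using \<kappa> by (auto simp: not_less intro: le_less_trans)
  then have "eventually (\<lambda>n. ereal ((real n * ln (real n)) powr (- 1 / p) * \<bar>D n\<bar>) < ereal (\<kappa> / 7)) sequentially"
    by (rule Limsup_lessD)
  then obtain N where N: "\<And>n. n \<ge> N \<Longrightarrow> (real n * ln (real n)) powr (- 1 / p) * \<bar>D n\<bar> < \<kappa> / 7"
    by (auto simp: eventually_sequentially)
  have small: "\<bar>D n\<bar> < \<kappa> / 7 * rate p n" if "n \<ge> N" "n \<ge> 3" for n
  proof -
    have "rate p n > 0" using rate_ge_one[of p n] that p by simp
    moreover have eq: "(real n * ln (real n)) powr (- 1 / p) = 1 / rate p n"
      by (simp add: rate_def powr_minus_divide)
    ultimately show ?thesis
      using N[OF that(1)] unfolding eq by (simp add: field_simps)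
  qed
  obtain n where n: "n \<ge> max N 3" "\<bar>D (n + sojourn_length p n) - D n\<bar> \<ge> \<kappa> * real (sojourn_length p n)"
    using large unfolding frequently_sequentially by blast
  have "\<kappa> * real (sojourn_length p n) < \<kappa> / 7 * rate p (n + sojourn_length p n) + \<kappa> / 7 * rate p n"
    using n small[of n] small[of "n + sojourn_length p n"] by simp
  also have "\<dots> \<le> \<kappa> / 7 * (6 * rate p n) + \<kappa> / 7 * rate p n"
    using rate_after_sojourn_le[OF p, of n] n \<kappa> by (intro add_right_mono mult_left_mono) auto
  also have "\<dots> = \<kappa> * rate p n"
    by simp
  also have "\<dots> \<le> \<kappa> * real (sojourn_length p n)"
    using rate_less_sojourn_length[of p n] \<kappa> by simp
  finally show False by simp
qed

section \<open>Infinitely many long sojourns\<close>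

context driven_chain
begin

text \<open>Almost surely the chain infinitely often makes a sojourn of length about \<open>b\<^sub>n\<close> below any given
  level. Up to the factor \<open>\<eta>\<^sub>n\<close>, the level \<open>x\<^sub>n\<close> is \<open>1 / b\<^sub>n\<close>, the largest one at which a sojourn of this
  length is likely.\<close>

lemma frequently_low_sojourn:
  assumes \<theta>: "\<theta> > 0"
  shows "AE w in M. \<exists>\<^sub>F n in sequentially. 0 \<le> W n w \<and> W n w \<le> \<theta> \<and>
    (\<forall>j\<le>sojourn_length (a + 1) n. W (n + j) w = W n w)"
proof -
  define p where "p = a + 1"
  have p: "p > 1" using a_pos by (simp add: p_def)
  \<comment> \<open>The values for \<open>n < 3\<close> are immaterial; with these, \<open>0 < c n \<le> 1\<close> for all \<open>n\<close>.\<close>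
  define c :: "nat \<Rightarrow> real" where "c = (\<lambda>n. if n < 3 then 1 else 1 / (real n * ln (real n)))"
  have c: "c n > 0" "c n \<le> 1" for n
  proof -
    have "real n * ln (real n) \<ge> 1" if "n \<ge> 3"
      using n_ln_n_ge[OF that] that by linarith
    then show "c n > 0" "c n \<le> 1"
      by (auto simp: c_def not_less intro: less_le_trans[OF zero_less_one])
  qed
  have c_div: "\<not> summable c"
  proof
    assume "summable c"
    then have "summable (\<lambda>n. 1 / (real n * ln (real n)))"
      by (rule summable_cong[THEN iffD1, rotated])
        (auto simp: c_def eventually_sequentially intro!: exI[of _ 3])
    with not_summable_inverse_n_ln_n show False by simp
  qed
  define S where "S = (\<lambda>n. \<Sum>k\<le>n. c k)"
  have S1: "S n \<ge> 1" for n
  proof -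
    have "c 0 \<le> S n" unfolding S_def using c(1) by (intro member_le_sum) (auto intro: less_imp_le)
    then show ?thesis by (simp add: c_def)
  qed
  \<comment> \<open>This power makes \<open>\<eta> n * z n\<close> equal to \<open>c n / S n\<close>, the borderline case of the Abel-Dini theorem.\<close>
  define \<eta> where "\<eta> = (\<lambda>n. S n powr (- 1 / (p + 1)))"
  have \<eta>: "\<eta> n > 0" "\<eta> n \<le> 1" for n
    using S1[of n] p powr_mono[of "- 1 / (p + 1)" 0 "S n"] by (auto simp: \<eta>_def)
  define x where "x = (\<lambda>n. \<eta> n * c n powr (1 / p))"
  define z where "z = (\<lambda>n. \<eta> n powr p * c n)"
  have cp: "c n powr (1 / p) \<le> 1" "c n powr (1 / p) > 0" for n
    using c[of n] p by (auto intro!: powr_le1)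
  have x: "0 \<le> x n" "x n \<le> 1" "x n \<le> c n powr (1 / p)" for n
    using \<eta>[of n] cp[of n] mult_mono[of "\<eta> n" 1 "c n powr (1 / p)" 1] by (auto simp: x_def mult_left_le_one_le)
  have z: "z n = x n powr p" for n
    using c[of n] p \<eta>[of n] by (simp add: z_def x_def powr_mult powr_powr)
  have prod: "\<eta> n * z n = c n / S n" for n
  proof -
    have "\<eta> n * \<eta> n powr p = \<eta> n powr (1 + p)"
      using \<eta>[of n] by (simp add: powr_add)
    also have "\<dots> = S n powr (- 1)"
      using p by (simp add: \<eta>_def powr_powr add.commute)
    finally have "\<eta> n * \<eta> n powr p = 1 / S n"
      using S1[of n] by (simp add: powr_minus_divide)
    then show ?thesis
      unfolding z_def mult.assoc[symmetric] by simp
  qed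
  have div_powr: "c n / S n * \<eta> n powr s = c n / S n powr (1 + s / (p + 1))" for n s
  proof -
    have "\<eta> n powr s = S n powr (- (s / (p + 1)))"
      by (simp add: \<eta>_def powr_powr)
    then show ?thesis
      using S1[of n] by (simp add: powr_add powr_minus_divide)
  qed
  have "AE w in M. \<exists>\<^sub>F n in sequentially. 0 \<le> W n w \<and> W n w \<le> x n \<and>
      (\<forall>j\<le>sojourn_length p n. W (n + j) w = W n w)"
  proof (rule frequently_long_sojourn[where y = \<eta> and z = z])
    show "\<not> summable (\<lambda>n. \<eta> n * z n)"
      unfolding prod S_def by (rule abel_dini_divergent[OF c(1) c_div])
    show "summable (\<lambda>n. \<eta> n * z n * \<eta> n powr a)"
      unfolding prod div_powr unfolding S_def using p a_pos by (intro abel_dini_convergent c(1)) auto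
    show "summable (\<lambda>n. \<eta> n * z n * (real (sojourn_length p n) * x n))"
    proof (rule summable_comparison_test'[where N = 3])
      have "summable (\<lambda>n. c n / S n powr (1 + 1 / (p + 1)))"
        unfolding S_def using p by (intro abel_dini_convergent c(1)) auto
      then show "summable (\<lambda>n. 2 * (c n / S n powr (1 + 1 / (p + 1))))"
        by (rule summable_mult)
    next
      fix n :: nat assume n: "n \<ge> 3"
      have "real (sojourn_length p n) * x n \<le> (2 * rate p n) * x n"
        using sojourn_length_le[of p n] rate_ge_one[of p n] p n x(1)[of n] by (intro mult_right_mono) auto
      also have "rate p n = 1 / c n powr (1 / p)"
        using n by (simp add: rate_def c_def powr_divide)
      also have "2 * (1 / c n powr (1 / p)) * x n = 2 * \<eta> n powr 1"
        using cp(2)[of n] \<eta>[of n] by (simp add: x_def)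
      finally have "\<eta> n * z n * (real (sojourn_length p n) * x n) \<le> c n / S n * (2 * \<eta> n powr 1)"
        unfolding prod using c(1)[of n] S1[of n] by (intro mult_left_mono) auto
      also have "\<dots> = 2 * (c n / S n * \<eta> n powr 1)" by simp
      also have "\<dots> = 2 * (c n / S n powr (1 + 1 / (p + 1)))" unfolding div_powr by simp
      finally show "norm (\<eta> n * z n * (real (sojourn_length p n) * x n)) \<le> 2 * (c n / S n powr (1 + 1 / (p + 1)))"
        using \<eta>[of n] x(1)[of n] c(1)[of n] by (simp add: z_def)
    qed
  qed (use x \<eta> z in \<open>auto simp: p_def intro: less_imp_le\<close>)
  moreover have "eventually (\<lambda>n. x n \<le> \<theta>) sequentially"
  proof -
    have "((\<lambda>n. (1 / (real n * ln (real n))) powr (1 / p)) \<longlongrightarrow> 0 powr (1 / p)) sequentially"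
    proof (rule tendsto_powr')
      show "(\<lambda>n. 1 / (real n * ln (real n))) \<longlonglongrightarrow> 0" by real_asymp
      show "(0 :: real) \<noteq> 0 \<or> 1 / p > 0 \<and> (\<forall>\<^sub>F n in sequentially. 1 / (real n * ln (real n)) \<ge> 0)"
        using p by (auto intro!: eventually_sequentiallyI[of 1])
    qed simp
    then have "eventually (\<lambda>n. (1 / (real n * ln (real n))) powr (1 / p) < \<theta>) sequentially"
      using \<theta> by (intro order_tendstoD(2)[of _ 0]) (simp_all)
    then show ?thesis
      using eventually_ge_at_top[of 3]
    proof eventually_elim
      case (elim n)
      then show ?case using x(3)[of n] by (simp add: c_def)
    qed
  qed
  ultimately show ?thesis
    unfolding p_def[symmetric]
  proof (elim eventually_mono)
    fix w
    assume freq: "\<exists>\<^sub>F n in sequentially. 0 \<le> W n w \<and> W n w \<le> x n \<and>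
        (\<forall>j\<le>sojourn_length p n. W (n + j) w = W n w)"
    and ev: "eventually (\<lambda>n. x n \<le> \<theta>) sequentially"
    show "\<exists>\<^sub>F n in sequentially. 0 \<le> W n w \<and> W n w \<le> \<theta> \<and>
        (\<forall>j\<le>sojourn_length p n. W (n + j) w = W n w)"
      using freq by (rule frequently_rev_mp) (use ev in \<open>auto elim!: eventually_mono\<close>)
  qed
qed

end

section \<open>Failure of the strong approximation rate\<close>

theorem proposition18:
  fixes M :: "'w measure" and p a :: real
    and \<epsilon> :: "int \<Rightarrow> 'w \<Rightarrow> real \<times> real" and W0 :: "'w \<Rightarrow> real"
    and W :: "nat \<Rightarrow> 'w \<Rightarrow> real"
  assumes M: "prob_space M"
    and p: "p > 2" and a: "a = p - 1"
    and innov: "prob_space.uniform_innovations M \<epsilon>"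
    and W0_law: "distr M borel W0 = nu_law a"
    and W0_indep: "prob_space.indep_pair M borel W0 (PiM UNIV (\<lambda>_. borel)) (\<lambda>w i. \<epsilon> i w)"
    and W: "W = chain a \<epsilon> W0"
  shows
    "(\<forall>W0' :: 'w \<Rightarrow> real.
        distr M borel W0' = nu_law a \<and>
        prob_space.indep_pair M borel W0'
          (borel \<Otimes>\<^sub>M PiM UNIV (\<lambda>_. borel)) (\<lambda>w. (W0 w, \<lambda>i. \<epsilon> i w)) \<longrightarrow>
        \<not> summable (\<lambda>n::nat. real (Suc n) powr (p - 2) *
            measure M {w \<in> space M. meeting_time W (chain a \<epsilon> W0') w \<ge> enat (Suc n)}))
     \<and>
     (\<forall>(f :: real \<Rightarrow> real) (f' :: real \<Rightarrow> real) (g :: int \<Rightarrow> 'w \<Rightarrow> real).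
        (\<forall>t\<in>{0..1}. (f has_real_derivative f' t) (at t within {0..1})) \<and>
        continuous_on {0..1} f' \<and> (\<forall>t\<in>{0..1}. f' t > 0) \<and>
        prob_space.stationary_sequence M g \<and> prob_space.gaussian_sequence M g \<and>
        prob_space.centered_sequence M g \<and> prob_space.convergent_covariances M g \<longrightarrow>
        (AE w in M. limsup (\<lambda>n::nat. ereal ((real n * ln (real n)) powr (- 1 / p) *
            \<bar>(\<Sum>k=1..n. f (W k w powr a)) - real n * integral {0..1} f
              - (\<Sum>k=1..n. g (int k) w)\<bar>)) > 0))"
proof (intro conjI allI impI; (elim conjE)?)
  interpret prob_space M by (rule M)
  interpret C: driven_chain M a \<epsilon> W0
    using p a innov W0_law W0_indep by unfold_locales auto
  have a1: "a + 1 = p" "a - 1 = p - 2" "a > 1" using p a by auto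
  {
    fix W0' :: "'w \<Rightarrow> real"
    assume "distr M borel W0' = nu_law a"
      and "indep_pair borel W0' (borel \<Otimes>\<^sub>M PiM UNIV (\<lambda>_. borel)) (\<lambda>w. (W0 w, \<lambda>i. \<epsilon> i w))"
    then show "\<not> summable (\<lambda>n::nat. real (Suc n) powr (p - 2) *
            measure M {w \<in> space M. meeting_time W (chain a \<epsilon> W0') w \<ge> enat (Suc n)})"
      using C.meeting_time_series_diverges[of W0'] unfolding W a1(2) by blast
  }
  fix f f' :: "real \<Rightarrow> real" and g :: "int \<Rightarrow> 'w \<Rightarrow> real"
  assume deriv: "\<forall>t\<in>{0..1}. (f has_real_derivative f' t) (at t within {0..1})"
    and pos: "\<forall>t\<in>{0..1}. f' t > 0"
    and g: "stationary_sequence g" "gaussian_sequence g" "centered_sequence g" "convergent_covariances g"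
  interpret G: gaussian_noise M g
    using g by unfold_locales
  define I where "I = integral {0..1} f"
  define \<delta> where "\<delta> = I - f 0"
  have \<delta>: "\<delta> > 0"
    using initial_value_less_integral[of f f'] deriv pos by (simp add: \<delta>_def I_def)
  have "continuous_on {0..1} f"
    using deriv DERIV_continuous_on by blast
  then obtain d where d: "d > 0" "\<And>t. t \<in> {0..1} \<Longrightarrow> dist t 0 < d \<Longrightarrow> dist (f t) (f 0) < \<delta> / 2"
    using \<delta> unfolding continuous_on_iff by (metis atLeastAtMost_iff half_gt_zero order_refl zero_le_one)
  define \<theta> where "\<theta> = min 1 (d / 2)"
  have \<theta>: "\<theta> > 0" using d by (simp add: \<theta>_def)
  have f_low: "f (v powr a) \<le> f 0 + \<delta> / 2" if v: "0 \<le> v" "v \<le> \<theta>" for v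
  proof -
    \<comment> \<open>Here \<open>v \<le> 1 < a\<close>.\<close>
    have "v powr a \<le> v powr 1"
      using v a1 by (intro powr_mono') (auto simp: \<theta>_def)
    then have "v powr a \<le> v" using v by simp
    then have "v powr a \<in> {0..1}" "dist (v powr a) 0 < d"
      using v d by (auto simp: \<theta>_def)
    then have "dist (f (v powr a)) (f 0) < \<delta> / 2" by (rule d)
    then show ?thesis unfolding dist_real_def by linarith
  qed
  let ?L = "sojourn_length p"
  have "AE w in M. eventually (\<lambda>n. \<bar>\<Sum>k=Suc n..n + ?L n. g (int k) w\<bar> < \<delta> / 4 * real (?L n)) sequentially"
    using \<delta> p by (intro G.eventually_increment_small[where K = "nat \<lceil>2 * p\<rceil>"] summable_inverse_sojourn_length_power)
      (auto simp: sojourn_length_def)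
  moreover have "AE w in M. \<exists>\<^sub>F n in sequentially. 0 \<le> W n w \<and> W n w \<le> \<theta> \<and> (\<forall>j\<le>?L n. W (n + j) w = W n w)"
    using C.frequently_low_sojourn[OF \<theta>] unfolding a1 W by simp
  ultimately show "AE w in M. limsup (\<lambda>n::nat. ereal ((real n * ln (real n)) powr (- 1 / p) *
            \<bar>(\<Sum>k=1..n. f (W k w powr a)) - real n * integral {0..1} f
              - (\<Sum>k=1..n. g (int k) w)\<bar>)) > 0"
  proof eventually_elim
    fix w
    assume small: "eventually (\<lambda>n. \<bar>\<Sum>k=Suc n..n + ?L n. g (int k) w\<bar> < \<delta> / 4 * real (?L n)) sequentially"
      and sojourn: "\<exists>\<^sub>F n in sequentially. 0 \<le> W n w \<and> W n w \<le> \<theta> \<and> (\<forall>j\<le>?L n. W (n + j) w = W n w)"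
    define D where "D = (\<lambda>n. (\<Sum>k=1..n. f (W k w powr a)) - real n * I - (\<Sum>k=1..n. g (int k) w))"
    \<comment> \<open>Over the sojourn the chain part of \<open>D\<close> loses at least \<open>\<delta> / 2 * ?L n\<close>, while the Gaussian part changes by less than half of this.\<close>
    have incr: "\<bar>D (n + ?L n) - D n\<bar> \<ge> \<delta> / 4 * real (?L n)"
      if n: "0 \<le> W n w" "W n w \<le> \<theta>" "\<forall>j\<le>?L n. W (n + j) w = W n w"
        and gn: "\<bar>\<Sum>k=Suc n..n + ?L n. g (int k) w\<bar> < \<delta> / 4 * real (?L n)" for n
    proof -
      have split: "(\<Sum>k=1..n + ?L n. h k) = (\<Sum>k=1..n. h k) + (\<Sum>k=Suc n..n + ?L n. h k)" for h :: "nat \<Rightarrow> real"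
        using sum.ub_add_nat[of 1 n h "?L n"] by simp
      have "W k w = W n w" if "k \<in> {Suc n..n + ?L n}" for k
        using n(3)[rule_format, of "k - n"] that by auto
      then have "(\<Sum>k=Suc n..n + ?L n. f (W k w powr a)) = real (?L n) * f (W n w powr a)"
        by simp
      then have "D (n + ?L n) - D n = real (?L n) * (f (W n w powr a) - I) - (\<Sum>k=Suc n..n + ?L n. g (int k) w)"
        unfolding D_def split by (simp add: algebra_simps)
      moreover have "real (?L n) * (f (W n w powr a) - I) \<le> real (?L n) * (- \<delta> / 2)"
        using f_low[OF n(1,2)] by (intro mult_left_mono) (auto simp: \<delta>_def field_simps)
      ultimately show ?thesis
        using gn by (simp add: abs_less_iff) argo
    qed
    have "\<exists>\<^sub>F n in sequentially. \<bar>D (n + ?L n) - D n\<bar> \<ge> \<delta> / 4 * real (?L n)"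
      using sojourn by (rule frequently_rev_mp) (use small incr in \<open>auto elim!: eventually_mono\<close>)
    then show "limsup (\<lambda>n::nat. ereal ((real n * ln (real n)) powr (- 1 / p) *
            \<bar>(\<Sum>k=1..n. f (W k w powr a)) - real n * integral {0..1} f
              - (\<Sum>k=1..n. g (int k) w)\<bar>)) > 0"
      using limsup_pos_of_large_increments[of p "\<delta> / 4" D] p \<delta> by (simp add: D_def I_def)
  qed
qed

end
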